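(* For every separable infinite dimensional real Banach space $X$ there exists an equivalent norm $|||\cdot|||$ on $X$ with the following property: if there exist $|||\cdot|||$-normalized basic sequences $(x_m)_{m\in\omega}$ and $(y_n)_{n\in\omega}$ in $X$ with $$\lim_{m\to\infty}\lim_{n\to\infty}|||x_m+y_n|||=2,$$ then $X$ is not reflexive.
   Context: $\omega=\{0,1,2,\ldots\}$. A sequence of non-zero vectors $(z_i)_{i\in\omega}$ is basic if there is $C<\infty$ with $\|\sum_{i=0}^{n-1}a_iz_i\|\le C\|\sum_{i=0}^{m-1}a_iz_i\|$ for all $n<m$ and all real scalars. A sequence is $|||\cdot|||$-normalized if all its terms have $|||\cdot|||$-norm $1$. *)

theory Defs
  imports "HOL-Analysis.Analysis"
begin

definition infinite_dimensional :: "'a::real_vector itself \<Rightarrow> bool" where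
  "infinite_dimensional _ \<longleftrightarrow> \<not> (\<exists>B::'a set. finite B \<and> span B = UNIV)"

definition is_norm :: "('a::real_vector \<Rightarrow> real) \<Rightarrow> bool" where
  "is_norm N \<longleftrightarrow>
     (\<forall>x. 0 \<le> N x) \<and>
     (\<forall>x. N x = 0 \<longleftrightarrow> x = 0) \<and>
     (\<forall>c x. N (c *\<^sub>R x) = \<bar>c\<bar> * N x) \<and>
     (\<forall>x y. N (x + y) \<le> N x + N y)"

definition equivalent_norm :: "('a::real_normed_vector \<Rightarrow> real) \<Rightarrow> bool" where
  "equivalent_norm N \<longleftrightarrow>
     is_norm N \<and> (\<exists>a>0. \<exists>b>0. \<forall>x. a * norm x \<le> N x \<and> N x \<le> b * norm x)"

text \<open>The constant \<open>C\<close> below depends on the norm, but whether a sequence is basic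
  does not change when the norm is replaced by an equivalent one.\<close>

definition basic_sequence :: "(nat \<Rightarrow> 'a::real_normed_vector) \<Rightarrow> bool" where
  "basic_sequence z \<longleftrightarrow>
     (\<forall>i. z i \<noteq> 0) \<and>
     (\<exists>C::real. \<forall>(a::nat \<Rightarrow> real) n m. n < m \<longrightarrow>
        norm (\<Sum>i<n. a i *\<^sub>R z i) \<le> C * norm (\<Sum>i<m. a i *\<^sub>R z i))"

definition normalized_wrt :: "('a \<Rightarrow> real) \<Rightarrow> (nat \<Rightarrow> 'a) \<Rightarrow> bool" where
  "normalized_wrt N z \<longleftrightarrow> (\<forall>i. N (z i) = 1)"

definition canonical_embedding ::
  "'a::real_normed_vector \<Rightarrow> (('a \<Rightarrow>\<^sub>L real) \<Rightarrow>\<^sub>L real)" where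
  "canonical_embedding x = Blinfun (\<lambda>f. blinfun_apply f x)"

lemma blinfun_apply_canonical_embedding [simp]:
  "blinfun_apply (canonical_embedding x) f = blinfun_apply f x"
  unfolding canonical_embedding_def
  by (subst bounded_linear_Blinfun_apply) (auto intro: bounded_linear_intros)

definition reflexive_space :: "'a::real_normed_vector itself \<Rightarrow> bool" where
  "reflexive_space _ \<longleftrightarrow>
     surj (canonical_embedding :: 'a \<Rightarrow> (('a \<Rightarrow>\<^sub>L real) \<Rightarrow>\<^sub>L real))"

end

theory Submission
  imports Defs
begin

text \<open>
  The norm, following Odell and Schlumprecht, is a weighted sum of the norms
  \<open>symm_norm z y = \<parallel>\<parallel>y\<parallel>z + y\<parallel> + \<parallel>\<parallel>y\<parallel>z - y\<parallel>\<close> with \<open>z\<close> ranging over a dense sequence. If two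
  normalized sequences satisfy \<open>lim lim N (x\<^sub>m + y\<^sub>n) = 2\<close>, then the triangle inequality is
  asymptotically an equality in each of these norms. After rescaling \<open>x\<close>, \<open>y\<close> to \<open>u\<close>, \<open>v\<close> with norms
  tending to \<open>1\<close>, this says that \<open>\<parallel>\<alpha>(z + u\<^sub>m) + \<beta>(z + v\<^sub>n)\<parallel>\<close> is asymptotically
  \<open>\<alpha>\<parallel>z + u\<^sub>m\<parallel> + \<beta>\<parallel>z + v\<^sub>n\<parallel>\<close> for every \<open>z\<close>. Hence, for \<open>\<beta>\<close> large, replacing
  \<open>\<alpha>u\<^sub>m + \<beta>v\<^sub>n\<close> by \<open>(\<alpha> + \<beta>)v\<^sub>n\<close> increases \<open>\<parallel>z + \<alpha>u\<^sub>m + \<beta>v\<^sub>n\<parallel>\<close> by at most a small multiple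
  of \<open>\<alpha>\<close>. Iterating along a
  fast subsequence of \<open>u\<close> and comparing with \<open>\<beta>v\<^sub>n\<close> shows that all convex combinations of this
  subsequence have norm at least \<open>1/4\<close>. In a reflexive space the closed convex hulls of its tails
  have a common point, which then is non-zero; but the closed spans of the tails of a basic
  sequence meet only in \<open>0\<close>.
\<close>

section \<open>Hahn--Banach and reflexivity\<close>

text \<open>Homogeneity is demanded only as an inequality for \<open>c > 0\<close>, which is easy to
  verify for infima; applied to \<open>1/c\<close> as well it yields the equality in
  \<open>sublinear_scaleR\<close>.\<close>

definition sublinear :: "('a::real_vector \<Rightarrow> real) \<Rightarrow> bool" where
  "sublinear p \<longleftrightarrow>
     (\<forall>x y. p (x + y) \<le> p x + p y) \<and> (\<forall>c>0. \<forall>x. p (c *\<^sub>R x) \<le> c * p x)"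

lemma sublinearD:
  assumes "sublinear p"
  shows "p (x + y) \<le> p x + p y" "c > 0 \<Longrightarrow> p (c *\<^sub>R x) \<le> c * p x"
  using assms by (auto simp: sublinear_def)

lemma sublinear_zero:
  assumes "sublinear p"
  shows "p 0 = 0"
  using sublinearD(2)[OF assms, of 2 0] sublinearD(2)[OF assms, of "1/2" 0] by simp

lemma sublinear_scaleR:
  assumes "sublinear p" "c \<ge> 0"
  shows "p (c *\<^sub>R x) = c * p x"
proof (cases "c = 0")
  case True
  then show ?thesis by (simp add: sublinear_zero[OF assms(1)])
next
  case False
  then have c: "c > 0" using assms by simp
  have "p ((1/c) *\<^sub>R (c *\<^sub>R x)) \<le> (1/c) * p (c *\<^sub>R x)"
    using sublinearD(2)[OF assms(1), of "1/c" "c *\<^sub>R x"] c by simp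
  then have "c * p x \<le> p (c *\<^sub>R x)" using c by (simp add: field_simps)
  with sublinearD(2)[OF assms(1) c, of x] show ?thesis by simp
qed

lemma sublinear_ge_neg:
  assumes "sublinear p"
  shows "- p (- x) \<le> p x"
  using sublinearD(1)[OF assms, of x "- x"] sublinear_zero[OF assms] by simp

text \<open>The functionals built below (a one-step decrease, the infimum of a chain, a separating
  functional, an upper limit) are all infima of sets \<open>S x\<close>. With this rule only
  witnesses in \<open>S (x + y)\<close> and \<open>S (c *\<^sub>R x)\<close> have to be
  exhibited.\<close>

lemma sublinear_Inf:
  fixes S :: "'a::real_vector \<Rightarrow> real set"
  assumes ne: "\<And>x. S x \<noteq> {}" and bdd: "\<And>x. bdd_below (S x)"
    and add: "\<And>x y a b. a \<in> S x \<Longrightarrow> b \<in> S y \<Longrightarrow> \<exists>c\<in>S (x + y). c \<le> a + b"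
    and scale: "\<And>x a c. c > 0 \<Longrightarrow> a \<in> S x \<Longrightarrow> \<exists>b\<in>S (c *\<^sub>R x). b \<le> c * a"
  shows "sublinear (\<lambda>x. Inf (S x))"
  unfolding sublinear_def
proof (intro conjI allI impI)
  fix x y
  have "Inf (S (x + y)) - b \<le> a" if "a \<in> S x" "b \<in> S y" for a b
    using add[OF that] cInf_lower[OF _ bdd, of _ "x + y"] by force
  then have "Inf (S (x + y)) - b \<le> Inf (S x)" if "b \<in> S y" for b
    using that by (intro cInf_greatest ne) auto
  then have "Inf (S (x + y)) - Inf (S x) \<le> b" if "b \<in> S y" for b
    using that by force
  then have "Inf (S (x + y)) - Inf (S x) \<le> Inf (S y)"
    by (intro cInf_greatest ne) auto
  then show "Inf (S (x + y)) \<le> Inf (S x) + Inf (S y)" by simp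
next
  fix c :: real and x assume c: "c > 0"
  have "Inf (S (c *\<^sub>R x)) / c \<le> a" if "a \<in> S x" for a
    using scale[OF c that] cInf_lower[OF _ bdd, of _ "c *\<^sub>R x"] c by (force simp: field_simps)
  then have "Inf (S (c *\<^sub>R x)) / c \<le> Inf (S x)"
    by (intro cInf_greatest ne) auto
  then show "Inf (S (c *\<^sub>R x)) \<le> c * Inf (S x)" using c by (simp add: field_simps)
qed

text \<open>Once \<open>q\<close> is odd, subadditivity at \<open>x + y\<close> and
  \<open>- y\<close> reverses the triangle inequality. Minimality is what makes \<open>q\<close>
  odd.\<close>

lemma minimal_sublinear_linear:
  assumes q: "sublinear q" and min: "\<And>r. sublinear r \<Longrightarrow> r \<le> q \<Longrightarrow> r = q"
  shows "linear q"
proof -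
  have neg: "q (- y) = - q y" for y
  proof -
    \<comment> \<open>The infimum of \<open>S x\<close> is a sublinear functional below \<open>q\<close> with value at most \<open>- q y\<close>
      at \<open>- y\<close>, so minimality forces \<open>q (- y) \<le> - q y\<close>.\<close>
    define S where "S x = (\<lambda>t. q (x + t *\<^sub>R y) - t * q y) ` {0..}" for x
    have ne: "S x \<noteq> {}" for x by (auto simp: S_def)
    have lower: "- q (- x) \<le> a" if "a \<in> S x" for x a
    proof -
      from that obtain t where t: "t \<ge> 0" "a = q (x + t *\<^sub>R y) - t * q y" by (auto simp: S_def)
      have "t * q y \<le> q (x + t *\<^sub>R y) + q (- x)"
        using sublinearD(1)[OF q, of "x + t *\<^sub>R y" "- x"] sublinear_scaleR[OF q t(1), of y] by simp
      then show ?thesis using t by simp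
    qed
    have bdd: "bdd_below (S x)" for x using lower by (rule bdd_belowI)
    have "sublinear (\<lambda>x. Inf (S x))"
    proof (rule sublinear_Inf[OF ne bdd])
      fix x x' a b assume "a \<in> S x" "b \<in> S x'"
      then obtain s t where st: "s \<ge> 0" "t \<ge> 0" "a = q (x + s *\<^sub>R y) - s * q y"
        "b = q (x' + t *\<^sub>R y) - t * q y" by (auto simp: S_def)
      have "q ((x + x') + (s + t) *\<^sub>R y) \<le> q (x + s *\<^sub>R y) + q (x' + t *\<^sub>R y)"
        using sublinearD(1)[OF q, of "x + s *\<^sub>R y" "x' + t *\<^sub>R y"] by (simp add: algebra_simps)
      then have "q ((x + x') + (s + t) *\<^sub>R y) - (s + t) * q y \<le> a + b"
        using st by (simp add: algebra_simps)
      moreover have "q ((x + x') + (s + t) *\<^sub>R y) - (s + t) * q y \<in> S (x + x')"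
        unfolding S_def using st by (intro image_eqI[of _ _ "s + t"]) auto
      ultimately show "\<exists>c\<in>S (x + x'). c \<le> a + b" by blast
    next
      fix x a and c :: real assume c: "c > 0" and "a \<in> S x"
      then obtain t where t: "t \<ge> 0" "a = q (x + t *\<^sub>R y) - t * q y" by (auto simp: S_def)
      have "q (c *\<^sub>R x + (c * t) *\<^sub>R y) = c * q (x + t *\<^sub>R y)"
        using sublinear_scaleR[OF q, of c "x + t *\<^sub>R y"] c by (simp add: algebra_simps)
      then have "q (c *\<^sub>R x + (c * t) *\<^sub>R y) - (c * t) * q y = c * a"
        using t by (simp only: right_diff_distrib mult.assoc)
      moreover have "q (c *\<^sub>R x + (c * t) *\<^sub>R y) - (c * t) * q y \<in> S (c *\<^sub>R x)"
        unfolding S_def using t c by (intro image_eqI[of _ _ "c * t"]) auto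
      ultimately show "\<exists>b\<in>S (c *\<^sub>R x). b \<le> c * a" by force
    qed
    moreover have "(\<lambda>x. Inf (S x)) \<le> q"
    proof (rule le_funI)
      fix x show "Inf (S x) \<le> q x"
        using cInf_lower[OF _ bdd, of "q x" x] by (force simp: S_def)
    qed
    ultimately have "(\<lambda>x. Inf (S x)) = q" by (rule min)
    then have "q (- y) = Inf (S (- y))" by metis
    also have "\<dots> \<le> q (- y + 1 *\<^sub>R y) - 1 * q y"
      by (rule cInf_lower[OF _ bdd], unfold S_def, rule imageI) simp
    finally have "q (- y) \<le> - q y" by (simp add: sublinear_zero[OF q])
    with sublinear_ge_neg[OF q, of y] show ?thesis by linarith
  qed
  show ?thesis
  proof (rule linearI)
    fix x y
    have "q x \<le> q (x + y) + q (- y)" using sublinearD(1)[OF q, of "x + y" "- y"] by simp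
    with neg[of y] sublinearD(1)[OF q, of x y] show "q (x + y) = q x + q y" by simp
  next
    fix c :: real and x
    show "q (c *\<^sub>R x) = c *\<^sub>R q x"
    proof (cases "c \<ge> 0")
      case True
      then show ?thesis by (simp add: sublinear_scaleR[OF q])
    next
      case False
      then show ?thesis using sublinear_scaleR[OF q, of "- c" x] neg[of "c *\<^sub>R x"] by simp
    qed
  qed
qed

text \<open>Zorn's lemma for the reversed pointwise order gives a minimal sublinear functional below
  \<open>p\<close>, which is linear. A nonempty chain is bounded below by its pointwise infimum,
  finite because every member \<open>q\<close> satisfies \<open>- p (- x) \<le> q x\<close>.\<close>

theorem Hahn_Banach_sublinear:
  fixes p :: "'a::real_vector \<Rightarrow> real"
  assumes p: "sublinear p"
  obtains f where "linear f" "\<And>x. f x \<le> p x"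
proof -
  define A where "A = {q. sublinear q \<and> q \<le> p}"
  have "\<exists>q\<in>A. \<forall>r\<in>A. q \<ge> r \<longrightarrow> r = q"
  proof (rule predicate_Zorn[where P = "(\<ge>)"])
    show "partial_order_on A (relation_of (\<ge>) A)"
      by (rule partial_order_on_relation_ofI) auto
  next
    fix C assume C: "C \<in> Chains (relation_of (\<ge>) A)"
    then have CA: "C \<subseteq> A" by (auto simp: Chains_def relation_of_def)
    have chain: "q \<le> r \<or> r \<le> q" if "q \<in> C" "r \<in> C" for q r
      using C that by (auto simp: Chains_def relation_of_def)
    show "\<exists>u\<in>A. \<forall>a\<in>C. u \<le> a"
    proof (cases "C = {}")
      case True
      then show ?thesis using p by (auto simp: A_def)
    next
      case False
      define S where "S x = (\<lambda>q. q x) ` C" for x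
      have ne: "S x \<noteq> {}" for x using False by (simp add: S_def)
      have bdd: "bdd_below (S x)" for x
      proof (rule bdd_belowI[of _ "- p (- x)"])
        fix a assume "a \<in> S x"
        then obtain q where q: "q \<in> C" "a = q x" by (auto simp: S_def)
        then have "sublinear q" "q (- x) \<le> p (- x)" using CA by (auto simp: A_def le_fun_def)
        then show "- p (- x) \<le> a" using sublinear_ge_neg[of q x] q by simp
      qed
      have "sublinear (\<lambda>x. Inf (S x))"
      proof (rule sublinear_Inf[OF ne bdd])
        fix x y a b assume "a \<in> S x" "b \<in> S y"
        then obtain q r where qr: "q \<in> C" "r \<in> C" "a = q x" "b = r y" by (auto simp: S_def)
        then obtain s where s: "s \<in> C" "s \<le> q" "s \<le> r" using chain by blast
        then have "s (x + y) \<le> s x + s y" using CA by (auto simp: A_def sublinear_def)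
        also have "\<dots> \<le> a + b" using s qr by (auto simp: le_fun_def intro: add_mono)
        finally show "\<exists>c\<in>S (x + y). c \<le> a + b" using s by (auto simp: S_def)
      next
        fix x a and c :: real assume "c > 0" "a \<in> S x"
        then show "\<exists>b\<in>S (c *\<^sub>R x). b \<le> c * a"
          using CA by (auto simp: S_def A_def sublinear_def subset_eq)
      qed
      moreover have le: "(\<lambda>x. Inf (S x)) \<le> q" if "q \<in> C" for q
      proof (rule le_funI)
        fix x show "Inf (S x) \<le> q x"
          by (rule cInf_lower[OF _ bdd]) (use that in \<open>auto simp: S_def\<close>)
      qed
      moreover have "(\<lambda>x. Inf (S x)) \<le> p"
        using le False CA order_trans unfolding A_def by blast
      ultimately show ?thesis by (auto simp: A_def)
    qed
  qed
  then obtain q where q: "q \<in> A" and min: "\<And>r. r \<in> A \<Longrightarrow> r \<le> q \<Longrightarrow> r = q" by blast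
  have "linear q"
    using q min by (intro minimal_sublinear_linear) (auto simp: A_def intro: order_trans)
  then show thesis using q that by (auto simp: A_def le_fun_def)
qed

lemma linear_le_norm_blinfun:
  fixes f :: "'a::real_normed_vector \<Rightarrow> real"
  assumes "linear f" "\<And>x. f x \<le> norm x * M"
  obtains F :: "'a \<Rightarrow>\<^sub>L real" where "blinfun_apply F = f"
proof -
  interpret linear f by fact
  have "norm (f x) \<le> norm x * M" for x
    using assms(2)[of x] assms(2)[of "- x"] by (simp add: neg abs_le_iff)
  then have "bounded_linear f" using assms(1)
    by (intro bounded_linear_intro) (auto simp: linear_add linear_scale)
  then show thesis using that bounded_linear_Blinfun_apply by blast
qed

lemma separation_point_convex:
  fixes C :: "'a::real_normed_vector set"
  assumes "convex C" "C \<noteq> {}" and dist: "\<And>k. k \<in> C \<Longrightarrow> d \<le> norm (k - w)"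
  obtains f :: "'a \<Rightarrow>\<^sub>L real" where "\<And>k. k \<in> C \<Longrightarrow> blinfun_apply f w + d \<le> blinfun_apply f k"
proof -
  \<comment> \<open>\<open>Inf (S y)\<close> is the largest sublinear functional that is at most \<open>norm\<close> everywhere and at
    most \<open>- d\<close> on \<open>w - C\<close>.\<close>
  define S where "S y = {norm (y + t *\<^sub>R (k - w)) - t * d |t k. t \<ge> 0 \<and> k \<in> C}" for y
  have ne: "S y \<noteq> {}" for y using \<open>C \<noteq> {}\<close> by (auto simp: S_def intro: exI[of _ 0])
  have bdd: "bdd_below (S y)" for y
  proof (rule bdd_belowI[of _ "- norm y"])
    fix a assume "a \<in> S y"
    then obtain t k where t: "t \<ge> 0" "k \<in> C" "a = norm (y + t *\<^sub>R (k - w)) - t * d"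
      by (auto simp: S_def)
    have "t * d \<le> norm (t *\<^sub>R (k - w))" using t dist[of k] by (simp add: mult_left_mono)
    also have "\<dots> \<le> norm (y + t *\<^sub>R (k - w)) + norm y"
      using norm_triangle_ineq4[of "y + t *\<^sub>R (k - w)" y] by simp
    finally show "- norm y \<le> a" using t by simp
  qed
  have "sublinear (\<lambda>y. Inf (S y))"
  proof (rule sublinear_Inf[OF ne bdd])
    fix x y a b assume "a \<in> S x" "b \<in> S y"
    then obtain s k t l where st: "s \<ge> 0" "k \<in> C" "a = norm (x + s *\<^sub>R (k - w)) - s * d"
      "t \<ge> 0" "l \<in> C" "b = norm (y + t *\<^sub>R (l - w)) - t * d"
      by (auto simp: S_def)
    \<comment> \<open>Convexity of \<open>C\<close> enters here: \<open>m\<close> is the average of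
      \<open>k\<close> and \<open>l\<close> with weights \<open>s\<close> and \<open>t\<close>, so a
      sum of two multiples of vectors in \<open>C - w\<close> is again such a multiple.\<close>
    obtain m where m: "m \<in> C" "(s + t) *\<^sub>R m = s *\<^sub>R k + t *\<^sub>R l"
    proof (cases "s + t = 0")
      case True
      then have "s = 0" "t = 0" using st by auto
      then show ?thesis using that st by auto
    next
      case False
      have "(s / (s + t)) *\<^sub>R k + (t / (s + t)) *\<^sub>R l \<in> C"
        using st False by (intro convexD[OF \<open>convex C\<close>]) (auto simp: add_divide_distrib[symmetric])
      then show ?thesis using False by (intro that) (auto simp: scaleR_add_right)
    qed
    have eq: "(s + t) *\<^sub>R (m - w) = s *\<^sub>R (k - w) + t *\<^sub>R (l - w)"
      using m by (simp add: algebra_simps)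
    have "norm (x + y + (s + t) *\<^sub>R (m - w)) \<le> norm (x + s *\<^sub>R (k - w)) + norm (y + t *\<^sub>R (l - w))"
      unfolding eq using norm_triangle_ineq[of "x + s *\<^sub>R (k - w)" "y + t *\<^sub>R (l - w)"]
      by (simp add: add_ac)
    then have "norm (x + y + (s + t) *\<^sub>R (m - w)) - (s + t) * d \<le> a + b"
      using st by (simp add: algebra_simps)
    moreover have "norm (x + y + (s + t) *\<^sub>R (m - w)) - (s + t) * d \<in> S (x + y)"
      using st m unfolding S_def by (intro CollectI exI[of _ "s + t"] exI[of _ m]) auto
    ultimately show "\<exists>c\<in>S (x + y). c \<le> a + b" by blast
  next
    fix x a and c :: real assume c: "c > 0" and "a \<in> S x"
    then obtain t k where t: "t \<ge> 0" "k \<in> C" "a = norm (x + t *\<^sub>R (k - w)) - t * d"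
      by (auto simp: S_def)
    have "norm (c *\<^sub>R x + (c * t) *\<^sub>R (k - w)) = c * norm (x + t *\<^sub>R (k - w))"
      using c norm_scaleR[of c "x + t *\<^sub>R (k - w)"] by (simp add: scaleR_add_right)
    then have "norm (c *\<^sub>R x + (c * t) *\<^sub>R (k - w)) - (c * t) * d = c * a"
      using t by (simp only: right_diff_distrib mult.assoc)
    moreover have "norm (c *\<^sub>R x + (c * t) *\<^sub>R (k - w)) - (c * t) * d \<in> S (c *\<^sub>R x)"
      using t c unfolding S_def by (intro CollectI exI[of _ "c * t"] exI[of _ k]) auto
    ultimately show "\<exists>b\<in>S (c *\<^sub>R x). b \<le> c * a" by force
  qed
  then obtain f where f: "linear f" and fle: "\<And>y. f y \<le> Inf (S y)"
    using Hahn_Banach_sublinear by blast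
  have le: "f y \<le> norm (y + t *\<^sub>R (k - w)) - t * d" if "t \<ge> 0" "k \<in> C" for y t k
  proof -
    have "norm (y + t *\<^sub>R (k - w)) - t * d \<in> S y" using that by (auto simp: S_def)
    then show ?thesis using fle[of y] cInf_lower[OF _ bdd] by force
  qed
  from \<open>C \<noteq> {}\<close> obtain k0 where "k0 \<in> C" by blast
  then have "f y \<le> norm y * 1" for y using le[of 0 k0 y] by simp
  then obtain F :: "'a \<Rightarrow>\<^sub>L real" where F: "blinfun_apply F = f"
    using linear_le_norm_blinfun[OF f, of 1] by blast
  \<comment> \<open>With \<open>t = 1\<close> and \<open>y = w - k\<close> the norm in
    \<open>le\<close> vanishes and only \<open>- d\<close> remains.\<close>
  have "f w + d \<le> f k" if "k \<in> C" for k
    using le[of 1 k "w - k"] that f by (simp add: linear_diff)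
  then show thesis using that F by metis
qed

text \<open>This replaces weak compactness: reflexivity turns a functional on the dual lying below
  the upper limit into evaluation at a point \<open>w\<close>. If \<open>w\<close> had positive
  distance from the hull of a tail, a separating \<open>f\<close> would keep the upper limit of
  \<open>- f\<close> along \<open>u\<close> strictly below its value at \<open>w\<close>.\<close>

lemma reflexive_closed_convex_tails:
  fixes u :: "nat \<Rightarrow> 'a::real_normed_vector"
  assumes refl: "reflexive_space TYPE('a)" and bound: "\<And>i. norm (u i) \<le> M"
  obtains w where "\<And>j. w \<in> closure (convex hull (u ` {j..}))"
proof -
  \<comment> \<open>\<open>Inf (S \<psi>)\<close> is the real-valued limit superior of \<open>\<psi> (u i)\<close>; a linear functional below
    it is an element of the bidual.\<close>
  define S where "S (\<psi> :: 'a \<Rightarrow>\<^sub>L real) = {c. \<forall>\<^sub>F i in sequentially. blinfun_apply \<psi> (u i) \<le> c}" for \<psi>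
  have "\<bar>blinfun_apply \<psi> (u i)\<bar> \<le> norm \<psi> * M" for \<psi> :: "'a \<Rightarrow>\<^sub>L real" and i
    using norm_blinfun[of \<psi> "u i"] bound[of i] mult_left_mono[of "norm (u i)" M "norm \<psi>"] by simp
  then have ub: "blinfun_apply \<psi> (u i) \<le> norm \<psi> * M" and lb: "- (norm \<psi> * M) \<le> blinfun_apply \<psi> (u i)"
    for \<psi> :: "'a \<Rightarrow>\<^sub>L real" and i
    by (simp_all add: abs_le_iff minus_le_iff)
  have mem: "norm \<psi> * M \<in> S \<psi>" for \<psi> by (simp add: S_def ub)
  then have ne: "S \<psi> \<noteq> {}" for \<psi> by blast
  have bdd: "bdd_below (S \<psi>)" for \<psi>
  proof (rule bdd_belowI[of _ "- (norm \<psi> * M)"])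
    fix c assume "c \<in> S \<psi>"
    then obtain i where "blinfun_apply \<psi> (u i) \<le> c"
      by (auto simp: S_def eventually_sequentially)
    then show "- (norm \<psi> * M) \<le> c" using lb[of \<psi> i] by simp
  qed
  have "sublinear (\<lambda>\<psi>. Inf (S \<psi>))"
  proof (rule sublinear_Inf[OF ne bdd])
    fix \<psi> \<phi> a b assume "a \<in> S \<psi>" "b \<in> S \<phi>"
    then have "\<forall>\<^sub>F i in sequentially. blinfun_apply (\<psi> + \<phi>) (u i) \<le> a + b"
      unfolding S_def mem_Collect_eq by eventually_elim (simp add: blinfun.add_left)
    then show "\<exists>c\<in>S (\<psi> + \<phi>). c \<le> a + b" by (auto simp: S_def)
  next
    fix \<psi> a and c :: real assume "c > 0" "a \<in> S \<psi>"
    then show "\<exists>b\<in>S (c *\<^sub>R \<psi>). b \<le> c * a"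
      by (intro bexI[of _ "c * a"]) (auto simp: S_def blinfun.scaleR_left)
  qed
  then obtain \<Phi> where \<Phi>: "linear \<Phi>" and le: "\<And>\<psi>. \<Phi> \<psi> \<le> Inf (S \<psi>)"
    using Hahn_Banach_sublinear by blast
  have le': "\<Phi> \<psi> \<le> c" if "c \<in> S \<psi>" for \<psi> c
    using le[of \<psi>] cInf_lower[OF that bdd] by linarith
  then have "\<Phi> \<psi> \<le> norm \<psi> * M" for \<psi> using mem by blast
  then obtain F :: "('a \<Rightarrow>\<^sub>L real) \<Rightarrow>\<^sub>L real" where F: "blinfun_apply F = \<Phi>"
    using linear_le_norm_blinfun[OF \<Phi>, of M] by blast
  from refl obtain w :: 'a where "canonical_embedding w = F"
    unfolding reflexive_space_def by (metis surjD)
  then have w: "\<Phi> \<psi> = blinfun_apply \<psi> w" for \<psi> using F by auto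
  have "w \<in> closure (convex hull (u ` {j..}))" for j
  proof (rule ccontr)
    assume "w \<notin> closure (convex hull (u ` {j..}))"
    then obtain d where d: "d > 0" "\<And>k. k \<in> convex hull (u ` {j..}) \<Longrightarrow> d \<le> norm (k - w)"
      unfolding closure_approachable dist_norm by (meson not_le)
    obtain f :: "'a \<Rightarrow>\<^sub>L real"
      where f: "\<And>k. k \<in> convex hull (u ` {j..}) \<Longrightarrow> blinfun_apply f w + d \<le> blinfun_apply f k"
      by (rule separation_point_convex[OF convex_convex_hull _ d(2)]) auto
    have "blinfun_apply (- f) (u i) \<le> - blinfun_apply f w - d" if "i \<ge> j" for i
      using f[of "u i"] that by (auto simp: blinfun.minus_left hull_inc)
    then have "- blinfun_apply f w - d \<in> S (- f)"
      by (auto simp: S_def eventually_sequentially)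
    then show False using le'[of _ "- f"] w[of "- f"] d(1) by (force simp: blinfun.minus_left)
  qed
  then show thesis using that by blast
qed

section \<open>Tails of basic sequences\<close>

lemma span_image_atLeast_sum:
  fixes x :: "nat \<Rightarrow> 'a::real_vector"
  assumes "t \<in> span (x ` {j..})"
  obtains a m where "t = (\<Sum>i<m. a i *\<^sub>R x i)" "\<And>i. i < j \<Longrightarrow> a i = 0"
proof -
  \<comment> \<open>Coefficients are also required to vanish from \<open>m\<close> on, so that in
    the induction step the sum can be padded to a longer range.\<close>
  have "\<exists>a m. t = (\<Sum>i<m. a i *\<^sub>R x i) \<and> (\<forall>i. i < j \<or> i \<ge> m \<longrightarrow> a i = 0)"
    using assms
  proof (induction rule: span_induct_alt)
    case base
    then show ?case by (intro exI[of _ "\<lambda>_. 0"] exI[of _ 0]) auto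
  next
    case (step c b t)
    then obtain k a m where k: "k \<ge> j" "b = x k" and a: "t = (\<Sum>i<m. a i *\<^sub>R x i)"
      "\<And>i. i < j \<or> i \<ge> m \<Longrightarrow> a i = 0" by auto
    let ?m = "max m (Suc k)"
    have "t = (\<Sum>i<?m. a i *\<^sub>R x i)"
      unfolding a(1) by (rule sum.mono_neutral_left) (auto simp: a(2))
    moreover have "c *\<^sub>R x k = (\<Sum>i<?m. (if i = k then c else 0) *\<^sub>R x i)"
      by (simp add: if_distrib[of "\<lambda>r. r *\<^sub>R _"] less_max_iff_disj cong: if_cong)
    ultimately have "c *\<^sub>R b + t = (\<Sum>i<?m. ((if i = k then c else 0) + a i) *\<^sub>R x i)"
      by (simp add: k scaleR_add_left sum.distrib)
    then show ?case using k a(2)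
      by (intro exI[of _ "\<lambda>i. (if i = k then c else 0) + a i"] exI[of _ ?m]) auto
  qed
  then show thesis using that by blast
qed

text \<open>Choose \<open>s\<close> near \<open>w\<close> in the span of the first \<open>N\<close>
  vectors and \<open>t\<close> near \<open>w\<close> in the span of the tail from \<open>N\<close>.
  Then \<open>s\<close> is an initial segment of the expansion of \<open>s - t\<close>, which is
  small, so the basis inequality makes \<open>s\<close>, and hence \<open>w\<close>, small.\<close>

lemma basic_sequence_span_tails:
  assumes "basic_sequence x" and w: "\<And>j. w \<in> closure (span (x ` {j..}))"
  shows "w = 0"
proof -
  obtain C where C: "\<And>(a::nat \<Rightarrow> real) n m. n < m \<Longrightarrow>
      norm (\<Sum>i<n. a i *\<^sub>R x i) \<le> C * norm (\<Sum>i<m. a i *\<^sub>R x i)"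
    using assms(1) unfolding basic_sequence_def by blast
  have "norm w \<le> e * (1 + \<bar>C\<bar> * 2)" if e: "e > 0" for e
  proof -
    obtain s where "s \<in> span (x ` {0..})" and s: "norm (w - s) < e"
      using w[of 0] e unfolding closure_approachable dist_norm by (metis norm_minus_commute)
    then obtain a N where a: "s = (\<Sum>i<N. a i *\<^sub>R x i)" using span_image_atLeast_sum by blast
    obtain t where "t \<in> span (x ` {N..})" and t: "norm (w - t) < e"
      using w[of N] e unfolding closure_approachable dist_norm by (metis norm_minus_commute)
    then obtain b m where b: "t = (\<Sum>i<m. b i *\<^sub>R x i)" "\<And>i. i < N \<Longrightarrow> b i = 0"
      using span_image_atLeast_sum by blast
    define c where "c i = (if i < N then a i else if i < m then - b i else 0)" for i
    \<comment> \<open>\<open>Suc N\<close> guarantees that the longer sum has strictly more than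
      \<open>N\<close> terms, as the basis inequality demands.\<close>
    let ?m = "max (Suc N) m"
    have "s = (\<Sum>i<N. c i *\<^sub>R x i)" unfolding a by (rule sum.cong) (auto simp: c_def)
    moreover have "s - t = (\<Sum>i<?m. c i *\<^sub>R x i)"
    proof -
      have "s = (\<Sum>i<?m. (if i < N then a i else 0) *\<^sub>R x i)"
        unfolding a by (rule sum.mono_neutral_cong_left) auto
      moreover have "t = (\<Sum>i<?m. (if i < m then b i else 0) *\<^sub>R x i)"
        unfolding b by (rule sum.mono_neutral_cong_left) auto
      ultimately have "s - t = (\<Sum>i<?m. ((if i < N then a i else 0) - (if i < m then b i else 0)) *\<^sub>R x i)"
        by (simp add: scaleR_diff_left sum_subtractf)
      also have "\<dots> = (\<Sum>i<?m. c i *\<^sub>R x i)"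
        by (rule sum.cong) (auto simp: c_def b(2))
      finally show ?thesis .
    qed
    ultimately have "norm s \<le> C * norm (s - t)" using C[of N ?m c] by simp
    also have "\<dots> \<le> \<bar>C\<bar> * norm (s - t)" by (intro mult_right_mono) auto
    also have "\<dots> \<le> \<bar>C\<bar> * (2 * e)"
      using s t norm_triangle_ineq4[of "w - t" "w - s"] by (intro mult_left_mono) auto
    finally show ?thesis using s norm_triangle_ineq[of "w - s" s] by (simp add: algebra_simps)
  qed
  note bound = this
  have pos: "1 + \<bar>C\<bar> * 2 > 0" by (simp add: add_pos_nonneg)
  have "norm w \<le> 0"
  proof (rule field_le_epsilon)
    fix d :: real assume "d > 0"
    then show "norm w \<le> 0 + d" using bound[of "d / (1 + \<bar>C\<bar> * 2)"] pos by simp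
  qed
  then show ?thesis by simp
qed

section \<open>The iterated limit filter\<close>

text \<open>Encoding the iterated limit as one filter makes the usual limit rules available. It is
  not the product filter: the threshold for \<open>n\<close> may depend on \<open>m\<close>.\<close>

definition iterated_sequentially :: "(nat \<times> nat) filter" where
  "iterated_sequentially =
     Abs_filter (\<lambda>P. \<forall>\<^sub>F m in sequentially. \<forall>\<^sub>F n in sequentially. P (m, n))"

lemma eventually_iterated_sequentially:
  "eventually P iterated_sequentially \<longleftrightarrow>
     (\<forall>\<^sub>F m in sequentially. \<forall>\<^sub>F n in sequentially. P (m, n))"
  unfolding iterated_sequentially_def
proof (rule eventually_Abs_filter, rule is_filter.intro)
  show "\<forall>\<^sub>F m in sequentially. \<forall>\<^sub>F n in sequentially. True" by simp
next
  fix P Q :: "nat \<times> nat \<Rightarrow> bool"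
  assume "\<forall>\<^sub>F m in sequentially. \<forall>\<^sub>F n in sequentially. P (m, n)"
    and "\<forall>\<^sub>F m in sequentially. \<forall>\<^sub>F n in sequentially. Q (m, n)"
  then show "\<forall>\<^sub>F m in sequentially. \<forall>\<^sub>F n in sequentially. P (m, n) \<and> Q (m, n)"
    by eventually_elim (rule eventually_conj)
next
  fix P Q :: "nat \<times> nat \<Rightarrow> bool"
  assume "\<forall>p. P p \<longrightarrow> Q p" and "\<forall>\<^sub>F m in sequentially. \<forall>\<^sub>F n in sequentially. P (m, n)"
  then show "\<forall>\<^sub>F m in sequentially. \<forall>\<^sub>F n in sequentially. Q (m, n)"
    by (elim eventually_mono) (auto elim: eventually_mono)
qed

text \<open>An open set around \<open>l\<close> contains \<open>L m\<close> for all large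
  \<open>m\<close>; being a neighbourhood of each such \<open>L m\<close>, it captures
  \<open>f (m, n)\<close> for large \<open>n\<close>.\<close>

lemma tendsto_iterated_sequentially:
  fixes l :: "'a::topological_space"
  assumes "\<And>m. (\<lambda>n. f (m, n)) \<longlonglongrightarrow> L m" and "L \<longlonglongrightarrow> l"
  shows "(f \<longlongrightarrow> l) iterated_sequentially"
proof (rule topological_tendstoI)
  fix S assume "open S" "l \<in> S"
  with assms(2) have "\<forall>\<^sub>F m in sequentially. L m \<in> S" by (rule topological_tendstoD)
  then show "\<forall>\<^sub>F p in iterated_sequentially. f p \<in> S"
    unfolding eventually_iterated_sequentially
    by eventually_elim (rule topological_tendstoD[OF assms(1) \<open>open S\<close>])
qed

lemma filterlim_fst_iterated_sequentially: "filterlim fst sequentially iterated_sequentially"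
  unfolding filterlim_iff eventually_iterated_sequentially by (auto elim: eventually_mono)

lemma filterlim_snd_iterated_sequentially: "filterlim snd sequentially iterated_sequentially"
  unfolding filterlim_iff eventually_iterated_sequentially by simp

lemma filterlim_map_prod_iterated_sequentially:
  assumes "strict_mono r" "strict_mono s"
  shows "filterlim (map_prod r s) iterated_sequentially iterated_sequentially"
  unfolding filterlim_iff eventually_iterated_sequentially
proof (intro allI impI)
  fix P :: "nat \<times> nat \<Rightarrow> bool"
  assume "\<forall>\<^sub>F m in sequentially. \<forall>\<^sub>F n in sequentially. P (m, n)"
  then have "\<forall>\<^sub>F m in sequentially. \<forall>\<^sub>F n in sequentially. P (r m, n)"
    by (rule eventually_subseq[OF assms(1)])
  then show "\<forall>\<^sub>F m in sequentially. \<forall>\<^sub>F n in sequentially. P (map_prod r s (m, n))"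
    by eventually_elim (auto dest: eventually_subseq[OF assms(2)])
qed

section \<open>The equivalent norm\<close>

text \<open>The factor \<open>norm y\<close> makes the expression positively homogeneous in
  \<open>y\<close>, and the two signs make it even.\<close>

definition symm_norm :: "'a::real_normed_vector \<Rightarrow> 'a \<Rightarrow> real" where
  "symm_norm z y = norm (norm y *\<^sub>R z + y) + norm (norm y *\<^sub>R z - y)"

text \<open>As a function of the coefficient of \<open>z\<close> the sum is convex and even, hence
  nondecreasing on nonnegative values: \<open>s\<close> is a convex combination of \<open>t\<close>
  and \<open>- t\<close>, where the sum takes equal values.\<close>

lemma symm_sum_mono:
  fixes z w :: "'a::real_normed_vector"
  assumes "0 \<le> s" "s \<le> t"
  shows "norm (s *\<^sub>R z + w) + norm (s *\<^sub>R z - w) \<le> norm (t *\<^sub>R z + w) + norm (t *\<^sub>R z - w)"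
proof (cases "t = 0")
  case True
  then show ?thesis using assms by simp
next
  case False
  then have t: "t > 0" using assms by simp
  define l where "l = (1 + s / t) / 2"
  have l: "0 \<le> l" "l \<le> 1" "l * t - (1 - l) * t = s"
    using assms t by (auto simp: l_def field_simps)
  have s: "s *\<^sub>R z = l *\<^sub>R t *\<^sub>R z - (1 - l) *\<^sub>R t *\<^sub>R z"
    by (simp only: scaleR_scaleR scaleR_left_diff_distrib[symmetric] l(3))
  have 1: "s *\<^sub>R z + w = l *\<^sub>R (t *\<^sub>R z + w) - (1 - l) *\<^sub>R (t *\<^sub>R z - w)"
    unfolding s by (simp add: algebra_simps)
  have 2: "s *\<^sub>R z - w = l *\<^sub>R (t *\<^sub>R z - w) - (1 - l) *\<^sub>R (t *\<^sub>R z + w)"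
    unfolding s by (simp add: algebra_simps)
  have "norm (s *\<^sub>R z + w) \<le> l * norm (t *\<^sub>R z + w) + (1 - l) * norm (t *\<^sub>R z - w)"
    unfolding 1 using norm_triangle_ineq4[of "l *\<^sub>R (t *\<^sub>R z + w)" "(1 - l) *\<^sub>R (t *\<^sub>R z - w)"] l
    by simp
  moreover have "norm (s *\<^sub>R z - w) \<le> l * norm (t *\<^sub>R z - w) + (1 - l) * norm (t *\<^sub>R z + w)"
    unfolding 2 using norm_triangle_ineq4[of "l *\<^sub>R (t *\<^sub>R z - w)" "(1 - l) *\<^sub>R (t *\<^sub>R z + w)"] l
    by simp
  ultimately show ?thesis by (simp add: algebra_simps)
qed

text \<open>Monotonicity allows the coefficient \<open>norm (x + y)\<close> to be enlarged to
  \<open>norm x + norm y\<close>; then the triangle inequality applies to each sign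
  separately.\<close>

lemma symm_norm_triangle: "symm_norm z (x + y) \<le> symm_norm z x + symm_norm z y"
proof -
  have "symm_norm z (x + y) \<le> norm ((norm x + norm y) *\<^sub>R z + (x + y)) + norm ((norm x + norm y) *\<^sub>R z - (x + y))"
    unfolding symm_norm_def by (rule symm_sum_mono) (auto intro: norm_triangle_ineq)
  also have "\<dots> \<le> (norm (norm x *\<^sub>R z + x) + norm (norm y *\<^sub>R z + y)) + (norm (norm x *\<^sub>R z - x) + norm (norm y *\<^sub>R z - y))"
    using norm_triangle_ineq[of "norm x *\<^sub>R z + x" "norm y *\<^sub>R z + y"]
      norm_triangle_ineq[of "norm x *\<^sub>R z - x" "norm y *\<^sub>R z - y"]
    by (intro add_mono) (simp_all add: algebra_simps)
  finally show ?thesis by (simp add: symm_norm_def)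
qed

lemma symm_norm_scaleR: "symm_norm z (c *\<^sub>R y) = \<bar>c\<bar> * symm_norm z y"
proof (cases "c \<ge> 0")
  case True
  then have "norm (c *\<^sub>R y) *\<^sub>R z + c *\<^sub>R y = c *\<^sub>R (norm y *\<^sub>R z + y)"
    "norm (c *\<^sub>R y) *\<^sub>R z - c *\<^sub>R y = c *\<^sub>R (norm y *\<^sub>R z - y)"
    by (simp_all add: algebra_simps)
  then show ?thesis unfolding symm_norm_def by (simp only: norm_scaleR distrib_left)
next
  case False
  then have "norm (c *\<^sub>R y) *\<^sub>R z + c *\<^sub>R y = (- c) *\<^sub>R (norm y *\<^sub>R z - y)"
    "norm (c *\<^sub>R y) *\<^sub>R z - c *\<^sub>R y = (- c) *\<^sub>R (norm y *\<^sub>R z + y)"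
    by (simp_all add: algebra_simps)
  then show ?thesis unfolding symm_norm_def by (simp only: norm_scaleR distrib_left abs_minus_cancel add.commute)
qed

lemma symm_norm_nonneg: "0 \<le> symm_norm z y"
  by (simp add: symm_norm_def)

lemma symm_norm_ge: "2 * norm y \<le> symm_norm z y"
  using symm_sum_mono[of 0 "norm y" z y] by (simp add: symm_norm_def)

lemma symm_norm_le: "symm_norm z y \<le> 2 * (1 + norm z) * norm y"
  using norm_triangle_ineq[of "norm y *\<^sub>R z" y] norm_triangle_ineq4[of "norm y *\<^sub>R z" y]
  by (simp add: symm_norm_def algebra_simps)

lemma symm_norm_Lipschitz: "\<bar>symm_norm z y - symm_norm z' y\<bar> \<le> 2 * norm y * norm (z - z')"
proof -
  have "\<bar>norm (norm y *\<^sub>R z + y) - norm (norm y *\<^sub>R z' + y)\<bar> \<le> norm y * norm (z - z')"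
    using norm_triangle_ineq3[of "norm y *\<^sub>R z + y" "norm y *\<^sub>R z' + y"]
    by (simp flip: scaleR_diff_right)
  moreover have "\<bar>norm (norm y *\<^sub>R z - y) - norm (norm y *\<^sub>R z' - y)\<bar> \<le> norm y * norm (z - z')"
    using norm_triangle_ineq3[of "norm y *\<^sub>R z - y" "norm y *\<^sub>R z' - y"]
    by (simp flip: scaleR_diff_right)
  ultimately show ?thesis unfolding symm_norm_def by linarith
qed

text \<open>The denominator is the constant of \<open>symm_norm_le\<close>, so the
  \<open>k\<close>-th term of \<open>renorm\<close> is at most
  \<open>(1/2) ^ Suc k * norm y\<close>, and these bounds sum to \<open>norm y\<close>.\<close>

definition renorm_weight :: "(nat \<Rightarrow> 'a::real_normed_vector) \<Rightarrow> nat \<Rightarrow> real" where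
  "renorm_weight c k = (1/2) ^ Suc k / (2 * (1 + norm (c k)))"

definition renorm :: "(nat \<Rightarrow> 'a::real_normed_vector) \<Rightarrow> 'a \<Rightarrow> real" where
  "renorm c y = (\<Sum>k. renorm_weight c k * symm_norm (c k) y)"

lemma renorm_weight_pos: "renorm_weight c k > 0"
  unfolding renorm_weight_def by (intro divide_pos_pos) (auto simp: add_pos_nonneg)

lemma renorm_term_le: "renorm_weight c k * symm_norm (c k) y \<le> (1/2) ^ Suc k * norm y"
proof -
  have "renorm_weight c k * symm_norm (c k) y \<le> renorm_weight c k * (2 * (1 + norm (c k)) * norm y)"
    by (intro mult_left_mono symm_norm_le less_imp_le renorm_weight_pos)
  also have "\<dots> = (1/2) ^ Suc k * norm y"
  proof -
    have *: "a / (2 * n) * (2 * n * b) = a * b" if "n > 0" for a b n :: real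
      using that by simp
    show ?thesis unfolding renorm_weight_def by (rule *) (simp add: add_pos_nonneg)
  qed
  finally show ?thesis .
qed

lemma renorm_term_nonneg: "0 \<le> renorm_weight c k * symm_norm (c k) y"
  by (intro mult_nonneg_nonneg symm_norm_nonneg less_imp_le renorm_weight_pos)

lemma sums_half_norm: "(\<lambda>k. (1/2) ^ Suc k * norm y) sums norm y"
  using sums_mult2[OF power_half_series, of "norm y"] by (simp only: mult_1)

lemma summable_renorm: "summable (\<lambda>k. renorm_weight c k * symm_norm (c k) y)"
proof (rule summable_comparison_test'[OF sums_summable[OF sums_half_norm[of y]], of 0])
  show "norm (renorm_weight c k * symm_norm (c k) y) \<le> (1/2) ^ Suc k * norm y" for k
    unfolding real_norm_def abs_of_nonneg[OF renorm_term_nonneg] by (rule renorm_term_le)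
qed

lemma renorm_le: "renorm c y \<le> norm y"
  using suminf_le[OF renorm_term_le summable_renorm sums_summable[OF sums_half_norm], of c y]
  by (simp only: renorm_def sums_unique[OF sums_half_norm, symmetric])

lemma renorm_ge_term: "renorm_weight c k * symm_norm (c k) y \<le> renorm c y"
proof -
  have "(\<Sum>i\<in>{k}. renorm_weight c i * symm_norm (c i) y) \<le> renorm c y"
    unfolding renorm_def
    by (rule sum_le_suminf[OF summable_renorm]) (use renorm_term_nonneg in auto)
  then show ?thesis by simp
qed

lemma renorm_ge: "2 * renorm_weight c 0 * norm y \<le> renorm c y"
proof -
  have "2 * renorm_weight c 0 * norm y \<le> renorm_weight c 0 * symm_norm (c 0) y"
    using symm_norm_ge[of y "c 0"] renorm_weight_pos[of c 0] by simp
  then show ?thesis using renorm_ge_term[of c 0 y] by simp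
qed

text \<open>Every term of the series has a nonnegative triangle deficit, so each single one is
  bounded by their sum.\<close>

lemma renorm_deficit:
  "renorm_weight c k * (symm_norm (c k) x + symm_norm (c k) y - symm_norm (c k) (x + y))
     \<le> renorm c x + renorm c y - renorm c (x + y)"
proof -
  let ?d = "\<lambda>k. renorm_weight c k * (symm_norm (c k) x + symm_norm (c k) y - symm_norm (c k) (x + y))"
  have "(\<lambda>k. renorm_weight c k * symm_norm (c k) x + renorm_weight c k * symm_norm (c k) y
      - renorm_weight c k * symm_norm (c k) (x + y)) sums (renorm c x + renorm c y - renorm c (x + y))"
    unfolding renorm_def by (intro sums_diff sums_add summable_sums summable_renorm)
  then have s: "?d sums (renorm c x + renorm c y - renorm c (x + y))"
    by (simp add: algebra_simps)
  have nn: "0 \<le> ?d k" for k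
    using symm_norm_triangle[of "c k" x y] renorm_weight_pos[of c k] by simp
  have "sum ?d {k} \<le> suminf ?d" by (rule sum_le_suminf[OF sums_summable[OF s]]) (use nn in auto)
  then show ?thesis using sums_unique[OF s] by simp
qed

lemma equivalent_norm_renorm: "equivalent_norm (renorm c)"
proof -
  have pos: "2 * renorm_weight c 0 > 0" using renorm_weight_pos[of c 0] by simp
  have "is_norm (renorm c)"
    unfolding is_norm_def
  proof (intro conjI allI)
    fix x show "0 \<le> renorm c x"
      by (rule order_trans[OF _ renorm_ge]) (use pos in simp)
    show "renorm c x = 0 \<longleftrightarrow> x = 0"
    proof
      assume "renorm c x = 0"
      then have "2 * renorm_weight c 0 * norm x \<le> 0" using renorm_ge[of c x] by simp
      then show "x = 0" using pos by (simp add: mult_le_0_iff)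
    qed (simp add: renorm_def symm_norm_def)
  next
    fix r x
    have "renorm c (r *\<^sub>R x) = (\<Sum>k. \<bar>r\<bar> * (renorm_weight c k * symm_norm (c k) x))"
      unfolding renorm_def symm_norm_scaleR by (simp only: mult.left_commute)
    also have "\<dots> = \<bar>r\<bar> * renorm c x" unfolding renorm_def by (rule suminf_mult[OF summable_renorm])
    finally show "renorm c (r *\<^sub>R x) = \<bar>r\<bar> * renorm c x" .
  next
    fix x y
    have "0 \<le> renorm_weight c 0 * (symm_norm (c 0) x + symm_norm (c 0) y - symm_norm (c 0) (x + y))"
      using symm_norm_triangle[of "c 0" x y] renorm_weight_pos[of c 0] by simp
    then show "renorm c (x + y) \<le> renorm c x + renorm c y"
      using renorm_deficit[of c 0 x y] by simp
  qed
  then show ?thesis unfolding equivalent_norm_def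
    using pos renorm_ge[of c] renorm_le[of c]
    by (intro conjI exI[of _ "2 * renorm_weight c 0"] exI[of _ 1]) auto
qed

text \<open>For \<open>z\<close> in the dense sequence this is \<open>renorm_deficit\<close>. Other
  \<open>z\<close> follow by approximation, because the deficit is Lipschitz in \<open>z\<close>
  uniformly over the bounded vectors \<open>x p\<close> and \<open>y p\<close>.\<close>

lemma symm_norm_deficit_tendsto:
  fixes c :: "nat \<Rightarrow> 'a::real_normed_vector"
  assumes dense: "closure (range c) = UNIV"
    and lim: "((\<lambda>p. renorm c (x p) + renorm c (y p) - renorm c (x p + y p)) \<longlongrightarrow> 0) F"
    and bound: "\<And>p. norm (x p) \<le> M" "\<And>p. norm (y p) \<le> M"
  shows "((\<lambda>p. symm_norm z (x p) + symm_norm z (y p) - symm_norm z (x p + y p)) \<longlongrightarrow> 0) F"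
proof -
  let ?D = "\<lambda>z p. symm_norm z (x p) + symm_norm z (y p) - symm_norm z (x p + y p)"
  have 1: "(?D (c k) \<longlongrightarrow> 0) F" for k
  proof (rule tendsto_sandwich[OF _ _ tendsto_const])
    show "\<forall>\<^sub>F p in F. 0 \<le> ?D (c k) p"
      using symm_norm_triangle[of "c k" "x _" "y _"] by simp
    show "\<forall>\<^sub>F p in F. ?D (c k) p \<le> (renorm c (x p) + renorm c (y p) - renorm c (x p + y p)) / renorm_weight c k"
      using renorm_deficit[of c k "x _" "y _"] renorm_weight_pos[of c k]
      by (simp add: pos_le_divide_eq mult.commute)
    show "((\<lambda>p. (renorm c (x p) + renorm c (y p) - renorm c (x p + y p)) / renorm_weight c k) \<longlongrightarrow> 0) F"
      using tendsto_divide[OF lim tendsto_const, of "renorm_weight c k"] renorm_weight_pos[of c k] by simp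
  qed
  show ?thesis
  proof (rule tendstoI)
    fix e :: real assume e: "e > 0"
    \<comment> \<open>The vectors \<open>x p\<close> and \<open>y p\<close> contribute
      \<open>2 * (1 + \<bar>M\<bar>)\<close> each to the Lipschitz constant, and their sum
      contributes twice as much.\<close>
    define K where "K = 8 * (1 + \<bar>M\<bar>)"
    have K: "K > 0" by (simp add: K_def add_pos_nonneg)
    obtain k where k: "norm (c k - z) < e / 2 / K"
      using dense closure_approachable[of z "range c"] e K unfolding dist_norm
      by (metis UNIV_I divide_pos_pos imageE zero_less_numeral)
    have K1: "K * norm (c k - z) < e / 2" using k K by (simp add: field_simps)
    have "\<forall>\<^sub>F p in F. dist (?D (c k) p) 0 < e / 2" using e by (intro tendstoD[OF 1]) simp
    then show "\<forall>\<^sub>F p in F. dist (?D z p) 0 < e"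
    proof eventually_elim
      case (elim p)
      have L: "\<bar>symm_norm (c k) v - symm_norm z v\<bar> \<le> 4 * (1 + \<bar>M\<bar>) * norm (c k - z)"
        if "norm v \<le> 2 * M" for v
      proof -
        have "2 * norm v * norm (c k - z) \<le> 4 * (1 + \<bar>M\<bar>) * norm (c k - z)"
          using that by (intro mult_right_mono) auto
        then show ?thesis using symm_norm_Lipschitz[of "c k" v z] by linarith
      qed
      have L': "\<bar>symm_norm (c k) v - symm_norm z v\<bar> \<le> 2 * (1 + \<bar>M\<bar>) * norm (c k - z)"
        if "norm v \<le> M" for v
      proof -
        have "2 * norm v * norm (c k - z) \<le> 2 * (1 + \<bar>M\<bar>) * norm (c k - z)"
          using that by (intro mult_right_mono) auto
        then show ?thesis using symm_norm_Lipschitz[of "c k" v z] by linarith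
      qed
      have "norm (x p + y p) \<le> 2 * M"
        using bound[of p] norm_triangle_ineq[of "x p" "y p"] by simp
      from L[OF this] L'[OF bound(1)[of p]] L'[OF bound(2)[of p]]
      have "\<bar>?D (c k) p - ?D z p\<bar> \<le> K * norm (c k - z)"
        unfolding K_def abs_le_iff by (simp add: algebra_simps)
      moreover have "\<bar>?D (c k) p\<bar> < e / 2" using elim by simp
      ultimately have "\<bar>?D z p\<bar> < e" using K1 by linarith
      then show ?case by simp
    qed
  qed
qed

section \<open>Asymptotic additivity of the norm\<close>

lemma symm_norm_zero_left: "symm_norm 0 y = 2 * norm y"
  by (simp add: symm_norm_def)

text \<open>Since the norms converge, the variable coefficients inside \<open>symm_norm\<close> can
  be frozen at their limits. The deficit then splits into parts for the two signs, both nonnegative,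
  so the part with the plus sign vanishes in the limit.\<close>

lemma norm_combination_tendsto:
  fixes x y :: "'i \<Rightarrow> 'a::real_normed_vector"
  assumes symm: "\<And>z. ((\<lambda>p. symm_norm z (x p) + symm_norm z (y p) - symm_norm z (x p + y p)) \<longlongrightarrow> 0) F"
    and nx: "((\<lambda>p. norm (x p)) \<longlongrightarrow> a) F" and ny: "((\<lambda>p. norm (y p)) \<longlongrightarrow> b) F"
  shows "((\<lambda>p. norm (a *\<^sub>R z + x p) + norm (b *\<^sub>R z + y p) - norm ((a + b) *\<^sub>R z + (x p + y p))) \<longlongrightarrow> 0) F"
    (is "(?D \<longlongrightarrow> 0) F")
proof (rule tendsto_sandwich[OF _ _ tendsto_const])
  have perturb: "\<bar>symm_norm z w - (norm (t *\<^sub>R z + w) + norm (t *\<^sub>R z - w))\<bar> \<le> 2 * norm z * \<bar>norm w - t\<bar>" for w t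
  proof -
    have "norm ((norm w *\<^sub>R z + w) - (t *\<^sub>R z + w)) = norm z * \<bar>norm w - t\<bar>"
      "norm ((norm w *\<^sub>R z - w) - (t *\<^sub>R z - w)) = norm z * \<bar>norm w - t\<bar>"
      by (simp_all flip: scaleR_diff_left)
    then show ?thesis
      using norm_triangle_ineq3[of "norm w *\<^sub>R z + w" "t *\<^sub>R z + w"]
        norm_triangle_ineq3[of "norm w *\<^sub>R z - w" "t *\<^sub>R z - w"]
      unfolding symm_norm_def by linarith
  qed
  show "\<forall>\<^sub>F p in F. 0 \<le> ?D p"
  proof (rule always_eventually, rule allI)
    fix p show "0 \<le> ?D p"
      using norm_triangle_ineq[of "a *\<^sub>R z + x p" "b *\<^sub>R z + y p"] by (simp add: algebra_simps)
  qed
  let ?R = "\<lambda>p. (symm_norm z (x p) + symm_norm z (y p) - symm_norm z (x p + y p))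
    + 2 * norm z * (\<bar>norm (x p) - a\<bar> + \<bar>norm (y p) - b\<bar> + \<bar>norm (x p + y p) - (a + b)\<bar>)"
  show "\<forall>\<^sub>F p in F. ?D p \<le> ?R p"
  proof (rule always_eventually, rule allI)
    fix p
    have "norm ((a + b) *\<^sub>R z - (x p + y p)) \<le> norm (a *\<^sub>R z - x p) + norm (b *\<^sub>R z - y p)"
      using norm_triangle_ineq[of "a *\<^sub>R z - x p" "b *\<^sub>R z - y p"] by (simp add: algebra_simps)
    then show "?D p \<le> ?R p"
      using perturb[of "x p" a] perturb[of "y p" b] perturb[of "x p + y p" "a + b"]
      unfolding distrib_left by linarith
  qed
  \<comment> \<open>The case \<open>z = 0\<close> identifies the limit of
    \<open>norm (x p + y p)\<close>, so the third coefficient can be frozen at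
    \<open>a + b\<close>.\<close>
  have "((\<lambda>p. norm (x p) + norm (y p)
      - (symm_norm 0 (x p) + symm_norm 0 (y p) - symm_norm 0 (x p + y p)) / 2) \<longlongrightarrow> a + b - 0 / 2) F"
    by (intro tendsto_intros symm nx ny) simp
  then have "((\<lambda>p. norm (x p + y p)) \<longlongrightarrow> a + b) F"
    by (simp add: symm_norm_zero_left field_simps)
  then have "(?R \<longlongrightarrow> 0 + 2 * norm z * (\<bar>a - a\<bar> + \<bar>b - b\<bar> + \<bar>(a + b) - (a + b)\<bar>)) F"
    by (intro tendsto_intros symm nx ny)
  then show "(?R \<longlongrightarrow> 0) F" by simp
qed

text \<open>Asymptotic additivity is first known for one pair of weights, the limits of the norms;
  the selection needs it for all nonnegative weights.\<close>

lemma weighted_norm_deficit_tendsto: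
  fixes P Q :: "'i \<Rightarrow> 'a::real_normed_vector"
  assumes lim: "((\<lambda>p. a * norm (P p) + b * norm (Q p) - norm (a *\<^sub>R P p + b *\<^sub>R Q p)) \<longlongrightarrow> 0) F"
    and ab: "a > 0" "b > 0" "\<alpha> \<ge> 0" "\<beta> \<ge> 0"
  shows "((\<lambda>p. \<alpha> * norm (P p) + \<beta> * norm (Q p) - norm (\<alpha> *\<^sub>R P p + \<beta> *\<^sub>R Q p)) \<longlongrightarrow> 0) F"
    (is "(?D \<longlongrightarrow> 0) F")
proof (rule tendsto_sandwich[OF _ _ tendsto_const])
  \<comment> \<open>With this choice \<open>l *\<^sub>R (a *\<^sub>R P + b *\<^sub>R Q) - (\<alpha> *\<^sub>R P + \<beta> *\<^sub>R Q)\<close> has nonnegative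
    coefficients, so the deficit for \<open>(\<alpha>, \<beta>)\<close> is at most \<open>l\<close> times that for \<open>(a, b)\<close>.\<close>
  define l where "l = \<alpha> / a + \<beta> / b"
  have l: "l * a - \<alpha> \<ge> 0" "l * b - \<beta> \<ge> 0" "l \<ge> 0" using ab by (auto simp: l_def field_simps)
  show "\<forall>\<^sub>F p in F. 0 \<le> ?D p"
  proof (rule always_eventually, rule allI)
    fix p show "0 \<le> ?D p"
      using norm_triangle_ineq[of "\<alpha> *\<^sub>R P p" "\<beta> *\<^sub>R Q p"] ab by simp
  qed
  show "\<forall>\<^sub>F p in F. ?D p \<le> l * (a * norm (P p) + b * norm (Q p) - norm (a *\<^sub>R P p + b *\<^sub>R Q p))"
  proof (rule always_eventually, rule allI)
    fix p
    have eq: "l *\<^sub>R (a *\<^sub>R P p + b *\<^sub>R Q p) =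
        (\<alpha> *\<^sub>R P p + \<beta> *\<^sub>R Q p) + (l * a - \<alpha>) *\<^sub>R P p + (l * b - \<beta>) *\<^sub>R Q p"
      by (simp add: algebra_simps)
    have "norm (l *\<^sub>R (a *\<^sub>R P p + b *\<^sub>R Q p)) = l * norm (a *\<^sub>R P p + b *\<^sub>R Q p)"
      using l by simp
    moreover have "norm (l *\<^sub>R (a *\<^sub>R P p + b *\<^sub>R Q p)) \<le> norm (\<alpha> *\<^sub>R P p + \<beta> *\<^sub>R Q p) +
        norm ((l * a - \<alpha>) *\<^sub>R P p) + norm ((l * b - \<beta>) *\<^sub>R Q p)"
      unfolding eq by (meson norm_triangle_ineq norm_triangle_le order_trans add_mono order_refl)
    ultimately have "l * norm (a *\<^sub>R P p + b *\<^sub>R Q p) \<le> norm (\<alpha> *\<^sub>R P p + \<beta> *\<^sub>R Q p) +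
        (l * a - \<alpha>) * norm (P p) + (l * b - \<beta>) * norm (Q p)"
      using l by simp
    then show "?D p \<le> l * (a * norm (P p) + b * norm (Q p) - norm (a *\<^sub>R P p + b *\<^sub>R Q p))"
      by (simp add: algebra_simps)
  qed
  show "((\<lambda>p. l * (a * norm (P p) + b * norm (Q p) - norm (a *\<^sub>R P p + b *\<^sub>R Q p))) \<longlongrightarrow> 0) F"
    using tendsto_mult[OF tendsto_const lim, of l] by simp
qed

text \<open>With \<open>w = z / (\<alpha> + \<beta>)\<close> the vector on the right is
  \<open>\<alpha>(w + u) + \<beta>(w + v)\<close>, whose norm is asymptotically additive. Replacing
  \<open>norm (w + u)\<close> by \<open>norm (w + v)\<close> costs at most \<open>2 * norm w\<close>
  in the limit, as \<open>norm u\<close> and \<open>norm v\<close> both tend to 1.\<close>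

lemma merge_lower_bound:
  fixes u v :: "'i \<Rightarrow> 'a::real_normed_vector"
  assumes lim: "\<And>z \<alpha> \<beta>. \<alpha> \<ge> 0 \<Longrightarrow> \<beta> \<ge> 0 \<Longrightarrow>
      ((\<lambda>p. \<alpha> * norm (z + u p) + \<beta> * norm (z + v p) - norm (\<alpha> *\<^sub>R (z + u p) + \<beta> *\<^sub>R (z + v p))) \<longlongrightarrow> 0) F"
    and nu: "((\<lambda>p. norm (u p)) \<longlongrightarrow> 1) F" and nv: "((\<lambda>p. norm (v p)) \<longlongrightarrow> 1) F"
    and ab: "\<alpha> \<ge> 0" "\<beta> > 0" and e: "e > 0"
  shows "\<forall>\<^sub>F p in F. norm (z + (\<alpha> + \<beta>) *\<^sub>R v p) - 2 * \<alpha> / (\<alpha> + \<beta>) * norm z - e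
           < norm (z + \<alpha> *\<^sub>R u p + \<beta> *\<^sub>R v p)"
proof -
  define s where "s = \<alpha> + \<beta>"
  have s: "s > 0" using ab by (simp add: s_def)
  define w where "w = (1 / s) *\<^sub>R z"
  let ?D = "\<lambda>p. \<alpha> * norm (w + u p) + \<beta> * norm (w + v p) - norm (\<alpha> *\<^sub>R (w + u p) + \<beta> *\<^sub>R (w + v p))"
  have "((\<lambda>p. ?D p + \<alpha> * (norm (v p) - norm (u p))) \<longlongrightarrow> 0 + \<alpha> * (1 - 1)) F"
    using ab by (intro tendsto_intros lim nu nv) auto
  then have "\<forall>\<^sub>F p in F. ?D p + \<alpha> * (norm (v p) - norm (u p)) < e"
    using e by (intro order_tendstoD) simp_all
  then show ?thesis
  proof eventually_elim
    case (elim p)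
    have z: "z = \<alpha> *\<^sub>R w + \<beta> *\<^sub>R w" using s by (simp add: w_def s_def flip: scaleR_add_left add_divide_distrib)
    have nw: "norm w = norm z / s" using s by (simp add: w_def)
    have 1: "\<alpha> *\<^sub>R (w + u p) + \<beta> *\<^sub>R (w + v p) = z + \<alpha> *\<^sub>R u p + \<beta> *\<^sub>R v p"
      by (subst z) (simp add: algebra_simps)
    have "z + (\<alpha> + \<beta>) *\<^sub>R v p = (\<alpha> + \<beta>) *\<^sub>R (w + v p)"
      by (subst z) (simp add: algebra_simps)
    then have "norm (z + (\<alpha> + \<beta>) *\<^sub>R v p) = \<alpha> * norm (w + v p) + \<beta> * norm (w + v p)"
      using ab by (simp add: distrib_right)
    moreover have "\<alpha> * norm (w + v p) \<le> \<alpha> * norm w + \<alpha> * norm (v p)"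
      using ab norm_triangle_ineq[of w "v p"] by (simp flip: distrib_left add: mult_left_mono)
    moreover have "\<alpha> * norm (u p) \<le> \<alpha> * norm (w + u p) + \<alpha> * norm w"
      using ab norm_triangle_ineq4[of "w + u p" w] by (simp flip: distrib_left add: mult_left_mono)
    moreover have "2 * \<alpha> / (\<alpha> + \<beta>) * norm z = 2 * (\<alpha> * norm w)"
      by (simp add: nw s_def)
    ultimately show ?case using elim unfolding 1 right_diff_distrib by linarith
  qed
qed

text \<open>The bound is imposed at the finitely many points of a net; the Lipschitz constant common
  to all \<open>p\<close> extends it to \<open>K\<close> at the price of another
  \<open>e\<close>.\<close>

lemma eventually_uniform_on_compact:
  fixes g :: "'i \<Rightarrow> 'b::metric_space \<Rightarrow> real"
  assumes "compact K" and pt: "\<And>q. q \<in> K \<Longrightarrow> \<forall>\<^sub>F p in F. - e < g p q"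
    and Lip: "\<And>p q q'. \<bar>g p q - g p q'\<bar> \<le> M * dist q q'" and e: "e > 0"
  shows "\<forall>\<^sub>F p in F. \<forall>q\<in>K. - (2 * e) < g p q"
proof -
  define d where "d = e / (1 + \<bar>M\<bar>)"
  have d: "d > 0" using e by (simp add: d_def add_pos_nonneg)
  have "\<exists>k. finite k \<and> k \<subseteq> K \<and> K \<subseteq> (\<Union>x\<in>k. ball x d)"
    using seq_compact_imp_totally_bounded[of K] \<open>compact K\<close> d compact_imp_seq_compact by blast
  then obtain k where k: "finite k" "k \<subseteq> K" "K \<subseteq> (\<Union>x\<in>k. ball x d)" by blast
  have "\<forall>\<^sub>F p in F. \<forall>q\<in>k. - e < g p q"
    using k pt by (intro eventually_ball_finite) auto
  then show ?thesis
  proof eventually_elim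
    case (elim p)
    show ?case
    proof
      fix q assume "q \<in> K"
      then obtain q' where q': "q' \<in> k" "dist q' q < d" using k(3) by auto
      have "M * dist q' q \<le> (1 + \<bar>M\<bar>) * dist q' q" by (intro mult_right_mono) auto
      also have "\<dots> \<le> (1 + \<bar>M\<bar>) * d" using q' by (intro mult_left_mono) auto
      also have "\<dots> = e" by (simp add: d_def)
      finally have "\<bar>g p q' - g p q\<bar> \<le> e" using Lip[of p q' q] by linarith
      then show "- (2 * e) < g p q" using elim q' by force
    qed
  qed
qed

section \<open>Selecting the subsequence\<close>

text \<open>
  A pair \<open>(z, s)\<close> stands for a nonnegative combination \<open>z\<close> of the vectors selected so far, with
  coefficients summing to \<open>s \<le> 1\<close>. In \<open>large_along\<close> the range of \<open>\<beta>\<close> shrinks with \<open>s\<close> because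
  adjoining a vector with weight \<open>t\<close> replaces \<open>\<beta>\<close> by \<open>\<beta> + t\<close>.
\<close>

definition admissible :: "real \<Rightarrow> ('a::real_normed_vector \<times> real) set \<Rightarrow> bool" where
  "admissible M K \<longleftrightarrow> compact K \<and> convex K \<and> (0, 0) \<in> K \<and>
     (\<forall>(z, s)\<in>K. 0 \<le> s \<and> s \<le> 1 \<and> norm z \<le> M * s)"

definition adjoin :: "('a::real_normed_vector \<times> real) set \<Rightarrow> 'a \<Rightarrow> ('a \<times> real) set" where
  "adjoin K x = (\<lambda>((z, s), t). (z + t *\<^sub>R x, s + t)) ` {((z, s), t). (z, s) \<in> K \<and> 0 \<le> t \<and> s + t \<le> 1}"

definition large_along :: "real \<Rightarrow> (nat \<Rightarrow> 'a::real_normed_vector) \<Rightarrow> ('a \<times> real) set \<Rightarrow> real \<Rightarrow> bool" where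
  "large_along B v K e \<longleftrightarrow> (\<forall>(z, s)\<in>K. \<forall>\<beta>. B \<le> \<beta> \<longrightarrow> \<beta> \<le> B + 1 - s \<longrightarrow>
     (\<forall>\<^sub>F n in sequentially. norm ((s + \<beta>) *\<^sub>R v n) - s / 2 - e \<le> norm (z + \<beta> *\<^sub>R v n)))"

lemma adjoinI:
  assumes "(z, s) \<in> K" "0 \<le> t" "s + t \<le> 1"
  shows "(z + t *\<^sub>R x, s + t) \<in> adjoin K x"
  unfolding adjoin_def using assms by (intro image_eqI[of _ _ "((z, s), t)"]) auto

lemma adjoinE:
  assumes "q \<in> adjoin K x"
  obtains z s t where "q = (z + t *\<^sub>R x, s + t)" "(z, s) \<in> K" "0 \<le> t" "s + t \<le> 1"
  using assms unfolding adjoin_def by auto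

lemma adjoin_superset:
  assumes "admissible M K"
  shows "K \<subseteq> adjoin K x"
proof
  fix q assume "q \<in> K"
  then show "q \<in> adjoin K x"
    using adjoinI[of "fst q" "snd q" K 0 x] assms by (force simp: admissible_def)
qed

lemma admissible_adjoin:
  assumes K: "admissible M K" and x: "norm x \<le> M"
  shows "admissible M (adjoin K x)"
  unfolding admissible_def
proof (intro conjI)
  have bounds: "0 \<le> s" "s \<le> 1" "norm z \<le> M * s" if "(z, s) \<in> K" for z s
    using K that by (auto simp: admissible_def)
  let ?T = "{((z, s), t). (z, s) \<in> K \<and> 0 \<le> t \<and> s + t \<le> 1}"
  have "?T = (K \<times> {0..1}) \<inter> {q. snd (fst q) + snd q \<le> 1}"
    using bounds by force
  moreover have "closed {q :: ('a \<times> real) \<times> real. snd (fst q) + snd q \<le> 1}"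
    by (intro closed_Collect_le continuous_intros)
  ultimately have "compact ?T"
    using K by (auto simp: admissible_def intro!: compact_Int_closed compact_Times)
  then show "compact (adjoin K x)"
    unfolding adjoin_def case_prod_unfold
    by (intro compact_continuous_image continuous_intros) (simp_all add: case_prod_unfold)
  show "convex (adjoin K x)"
  proof (rule convexI)
    fix p q and a b :: real
    assume "p \<in> adjoin K x" "q \<in> adjoin K x" and ab: "0 \<le> a" "0 \<le> b" "a + b = 1"
    then obtain z s t z' s' t' where p: "p = (z + t *\<^sub>R x, s + t)" "(z, s) \<in> K" "0 \<le> t" "s + t \<le> 1"
      and q: "q = (z' + t' *\<^sub>R x, s' + t')" "(z', s') \<in> K" "0 \<le> t'" "s' + t' \<le> 1"
      by (elim adjoinE) blast
    have "a *\<^sub>R (z, s) + b *\<^sub>R (z', s') \<in> K"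
      using K p q ab by (intro convexD[of K]) (auto simp: admissible_def)
    then have 1: "(a *\<^sub>R z + b *\<^sub>R z', a * s + b * s') \<in> K" by simp
    have "a * (s + t) + b * (s' + t') \<le> a * 1 + b * 1"
      using p q ab by (intro add_mono mult_left_mono) auto
    then have "(a * s + b * s') + (a * t + b * t') \<le> 1" using ab by (simp add: algebra_simps)
    from adjoinI[OF 1 _ this, of x] show "a *\<^sub>R p + b *\<^sub>R q \<in> adjoin K x"
      using p q ab by (simp add: algebra_simps)
  qed
  show "(0, 0) \<in> adjoin K x"
    using adjoin_superset[OF K] K by (auto simp: admissible_def)
  show "\<forall>(z, s)\<in>adjoin K x. 0 \<le> s \<and> s \<le> 1 \<and> norm z \<le> M * s"
  proof (clarify elim!: adjoinE)
    fix z s t assume q: "(z, s) \<in> K" "0 \<le> t" "s + t \<le> 1"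
    have "norm (z + t *\<^sub>R x) \<le> norm z + t * norm x"
      using q norm_triangle_ineq[of z "t *\<^sub>R x"] by simp
    also have "\<dots> \<le> M * s + t * M" using bounds[OF q(1)] q x by (intro add_mono mult_left_mono) auto
    finally show "0 \<le> s + t \<and> s + t \<le> 1 \<and> norm (z + t *\<^sub>R x) \<le> M * (s + t)"
      using bounds[OF q(1)] q by (simp add: algebra_simps)
  qed
qed

text \<open>The vector \<open>z + \<alpha> u m + \<beta> v n\<close> is compared with
  \<open>z + (\<alpha> + \<beta>) v n\<close> at a loss of \<open>\<alpha> / 2 + d\<close>, and then
  \<open>large\<close> is applied. Uniformity over the compact set \<open>T\<close> lets a single
  \<open>m\<close> serve all combinations.\<close>

lemma large_along_adjoin:
  fixes u v :: "nat \<Rightarrow> 'a::real_normed_vector"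
  assumes merge: "\<And>z \<alpha> \<beta> e. \<alpha> \<ge> 0 \<Longrightarrow> \<beta> > 0 \<Longrightarrow> e > 0 \<Longrightarrow>
      \<forall>\<^sub>F p in iterated_sequentially.
        norm (z + (\<alpha> + \<beta>) *\<^sub>R v (snd p)) - 2 * \<alpha> / (\<alpha> + \<beta>) * norm z - e
          < norm (z + \<alpha> *\<^sub>R u (fst p) + \<beta> *\<^sub>R v (snd p))"
    and M: "M > 0" "\<And>m. norm (u m) \<le> M" "\<And>n. norm (v n) \<le> M"
    and K: "admissible M K" and large: "large_along (4 * M) v K e" and d: "d > 0"
  shows "\<forall>\<^sub>F m in sequentially. large_along (4 * M) v (adjoin K (u m)) (e + d)"
proof -
  define B where "B = 4 * M"
  have B: "B > 0" using M by (simp add: B_def)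
  have bounds: "0 \<le> s" "s \<le> 1" "norm z \<le> M * s" if "(z, s) \<in> K" for z s
    using K that by (auto simp: admissible_def)
  define T where "T = fst ` K \<times> {0..1::real} \<times> {B..B+1}"
  define g where "g p q = (case q of (z, \<alpha>, \<beta>) \<Rightarrow>
      norm (z + \<alpha> *\<^sub>R u (fst p) + \<beta> *\<^sub>R v (snd p)) - norm (z + (\<alpha> + \<beta>) *\<^sub>R v (snd p)) + \<alpha> / 2)"
    for p :: "nat \<times> nat" and q :: "'a \<times> real \<times> real"
  have "compact T"
    unfolding T_def using K
    by (intro compact_Times compact_continuous_image continuous_intros) (auto simp: admissible_def)
  moreover have "\<forall>\<^sub>F p in iterated_sequentially. - (d / 2) < g p q" if "q \<in> T" for q
  proof -
    obtain z \<alpha> \<beta> s where q: "q = (z, \<alpha>, \<beta>)" "(z, s) \<in> K" "0 \<le> \<alpha>" "\<alpha> \<le> 1" "B \<le> \<beta>"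
      using \<open>q \<in> T\<close> unfolding T_def by auto
    \<comment> \<open>The bound \<open>4 * M\<close> on \<open>\<beta>\<close> is chosen here: with
      \<open>norm z \<le> M\<close> it makes the merging loss at most
      \<open>\<alpha> / 2\<close>.\<close>
    have "norm z \<le> M * 1"
      using bounds[OF q(2)] M by (intro order_trans[OF bounds(3)[OF q(2)]] mult_left_mono) auto
    then have "2 * \<alpha> * norm z \<le> 2 * \<alpha> * M" using q by (intro mult_left_mono) auto
    also have "\<dots> \<le> \<alpha> / 2 * \<beta>" using q mult_left_mono[of "4 * M" \<beta> \<alpha>] unfolding B_def by simp
    also have "\<dots> \<le> \<alpha> / 2 * (\<alpha> + \<beta>)" using q by (intro mult_left_mono) auto
    finally have "2 * \<alpha> / (\<alpha> + \<beta>) * norm z \<le> \<alpha> / 2"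
      using q B by (simp add: divide_le_eq)
    moreover have "\<forall>\<^sub>F p in iterated_sequentially.
        norm (z + (\<alpha> + \<beta>) *\<^sub>R v (snd p)) - 2 * \<alpha> / (\<alpha> + \<beta>) * norm z - d / 2
          < norm (z + \<alpha> *\<^sub>R u (fst p) + \<beta> *\<^sub>R v (snd p))"
      using q B d by (intro merge) auto
    ultimately show ?thesis by (elim eventually_mono) (simp add: g_def q)
  qed
  \<comment> \<open>Each of the two norms contributes \<open>1 + 2 * M\<close>, and the summand
    \<open>\<alpha> / 2\<close> at most 1.\<close>
  moreover have "\<bar>g p q - g p q'\<bar> \<le> (3 + 4 * M) * dist q q'" for p q q'
  proof -
    obtain z \<alpha> \<beta> z' \<alpha>' \<beta>' where q: "q = (z, \<alpha>, \<beta>)" "q' = (z', \<alpha>', \<beta>')" by (metis prod_cases3)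
    let ?d = "dist q q'"
    have dz: "norm (z - z') \<le> ?d"
      using dist_fst_le[of q q'] by (simp add: q dist_norm)
    have da: "\<bar>\<alpha> - \<alpha>'\<bar> \<le> ?d"
      using dist_fst_le[of "snd q" "snd q'"] dist_snd_le[of q q'] by (simp add: q dist_norm)
    have db: "\<bar>\<beta> - \<beta>'\<bar> \<le> ?d"
      using dist_snd_le[of "snd q" "snd q'"] dist_snd_le[of q q'] by (simp add: q dist_norm)
    have scale: "norm (t *\<^sub>R w) \<le> M * ?d" if "\<bar>t\<bar> \<le> ?d" "norm w \<le> M" for t and w :: 'a
      using that M mult_mono[of "\<bar>t\<bar>" ?d "norm w" M] by (simp add: mult.commute)
    have "norm ((z + \<alpha> *\<^sub>R u (fst p) + \<beta> *\<^sub>R v (snd p)) - (z' + \<alpha>' *\<^sub>R u (fst p) + \<beta>' *\<^sub>R v (snd p)))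
        = norm ((z - z') + (\<alpha> - \<alpha>') *\<^sub>R u (fst p) + (\<beta> - \<beta>') *\<^sub>R v (snd p))"
      by (simp add: algebra_simps)
    also have "\<dots> \<le> ?d + M * ?d + M * ?d"
      by (intro norm_triangle_le add_mono dz scale da db M)
    finally have 1: "\<bar>norm (z + \<alpha> *\<^sub>R u (fst p) + \<beta> *\<^sub>R v (snd p)) - norm (z' + \<alpha>' *\<^sub>R u (fst p) + \<beta>' *\<^sub>R v (snd p))\<bar> \<le> ?d + M * ?d + M * ?d"
      using norm_triangle_ineq3 order_trans by blast
    have "norm ((z + (\<alpha> + \<beta>) *\<^sub>R v (snd p)) - (z' + (\<alpha>' + \<beta>') *\<^sub>R v (snd p)))
        = norm ((z - z') + (\<alpha> - \<alpha>') *\<^sub>R v (snd p) + (\<beta> - \<beta>') *\<^sub>R v (snd p))"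
      by (simp add: algebra_simps)
    also have "\<dots> \<le> ?d + M * ?d + M * ?d"
      by (intro norm_triangle_le add_mono dz scale da db M)
    finally have 2: "\<bar>norm (z + (\<alpha> + \<beta>) *\<^sub>R v (snd p)) - norm (z' + (\<alpha>' + \<beta>') *\<^sub>R v (snd p))\<bar> \<le> ?d + M * ?d + M * ?d"
      using norm_triangle_ineq3 order_trans by blast
    have "\<bar>\<alpha> / 2 - \<alpha>' / 2\<bar> \<le> ?d" using da by linarith
    with 1 2 show ?thesis unfolding g_def q prod.case distrib_right
      by (simp add: mult.assoc)
  qed
  ultimately have "\<forall>\<^sub>F p in iterated_sequentially. \<forall>q\<in>T. - (2 * (d / 2)) < g p q"
    using d by (intro eventually_uniform_on_compact[where M = "3 + 4 * M"]) auto
  then have "\<forall>\<^sub>F m in sequentially. \<forall>\<^sub>F n in sequentially. \<forall>q\<in>T. - d < g (m, n) q"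
    by (simp add: eventually_iterated_sequentially)
  then show ?thesis
  proof eventually_elim
    case (elim m)
    show ?case
      unfolding large_along_def B_def[symmetric]
    proof (clarify elim!: adjoinE)
      fix \<beta> z s \<alpha>
      assume q: "B \<le> \<beta>" "\<beta> \<le> B + 1 - (s + \<alpha>)" "(z, s) \<in> K" "0 \<le> \<alpha>" "s + \<alpha> \<le> 1"
      \<comment> \<open>\<open>large\<close> is used at \<open>\<alpha> + \<beta>\<close>, which
        lies in its range because \<open>\<beta> \<le> B + 1 - (s + \<alpha>)\<close>.\<close>
      have "\<forall>\<^sub>F n in sequentially.
          norm ((s + (\<alpha> + \<beta>)) *\<^sub>R v n) - s / 2 - e \<le> norm (z + (\<alpha> + \<beta>) *\<^sub>R v n)"
        using large q unfolding large_along_def B_def[symmetric] by fastforce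
      with elim show "\<forall>\<^sub>F n in sequentially.
          norm ((s + \<alpha> + \<beta>) *\<^sub>R v n) - (s + \<alpha>) / 2 - (e + d) \<le> norm (z + \<alpha> *\<^sub>R u m + \<beta> *\<^sub>R v n)"
      proof eventually_elim
        case (elim n)
        have "(z, \<alpha>, \<beta>) \<in> T" using q bounds[OF q(3)] by (force simp: T_def)
        then have "- d < g (m, n) (z, \<alpha>, \<beta>)" using elim by blast
        with elim show ?case by (simp add: g_def add.assoc add_divide_distrib)
      qed
    qed
  qed
qed

lemma subsequence_convex_hull_bounded_away:
  fixes u v :: "nat \<Rightarrow> 'a::real_normed_vector"
  assumes merge: "\<And>z \<alpha> \<beta> e. \<alpha> \<ge> 0 \<Longrightarrow> \<beta> > 0 \<Longrightarrow> e > 0 \<Longrightarrow>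
      \<forall>\<^sub>F p in iterated_sequentially.
        norm (z + (\<alpha> + \<beta>) *\<^sub>R v (snd p)) - 2 * \<alpha> / (\<alpha> + \<beta>) * norm z - e
          < norm (z + \<alpha> *\<^sub>R u (fst p) + \<beta> *\<^sub>R v (snd p))"
    and M: "M > 0" "\<And>m. norm (u m) \<le> M" "\<And>n. norm (v n) \<le> M"
    and nv: "(\<lambda>n. norm (v n)) \<longlonglongrightarrow> 1"
  obtains r :: "nat \<Rightarrow> nat" where "strict_mono r" "\<And>z. z \<in> convex hull (range (u \<circ> r)) \<Longrightarrow> 1 / 4 \<le> norm z"
proof -
  \<comment> \<open>The error starts at 0 and grows by \<open>(1/2) ^ k / 8\<close> in step
    \<open>k\<close>, so it never exceeds 1/4.\<close>
  define err where "err k = (1 - (1/2) ^ k) / (4::real)" for k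
  define P where "P k S \<longleftrightarrow> admissible M (fst S) \<and> large_along (4 * M) v (fst S) (err k)"
    for k and S :: "('a \<times> real) set \<times> nat"
  define Q where "Q k S S' \<longleftrightarrow> snd S < snd S' \<and> fst S' = adjoin (fst S) (u (snd S'))"
    for k :: nat and S S' :: "('a \<times> real) set \<times> nat"
  have "\<exists>f. \<forall>k. P k (f k) \<and> Q k (f k) (f (Suc k))"
  proof (rule dependent_nat_choice)
    show "\<exists>S. P 0 S"
      by (rule exI[of _ "({(0, 0)}, 0)"]) (simp add: P_def admissible_def large_along_def err_def)
  next
    fix S k assume S: "P k S"
    have "err (Suc k) = err k + (1/2) ^ k / 8" by (simp add: err_def field_simps)
    with S have "\<forall>\<^sub>F m in sequentially. large_along (4 * M) v (adjoin (fst S) (u m)) (err (Suc k))"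
      using large_along_adjoin[OF merge M, of "fst S" "err k" "(1/2) ^ k / 8"] by (simp add: P_def)
    from eventually_conj[OF this eventually_gt_at_top[of "snd S"]]
    obtain m where m: "large_along (4 * M) v (adjoin (fst S) (u m)) (err (Suc k))" "snd S < m"
      by (metis (mono_tags, lifting) eventually_happens' sequentially_bot)
    then have "P (Suc k) (adjoin (fst S) (u m), m) \<and> Q k S (adjoin (fst S) (u m), m)"
      using S M by (simp add: P_def Q_def admissible_adjoin)
    then show "\<exists>S'. P (Suc k) S' \<and> Q k S S'" ..
  qed
  then obtain f where f: "\<And>k. P k (f k)" "\<And>k. Q k (f k) (f (Suc k))" by blast
  define K where "K k = fst (f k)" for k
  \<comment> \<open>The shift skips the index stored in the initial state, which belongs to no
    selected vector.\<close>
  define r where "r k = snd (f (Suc k))" for k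
  have adm: "admissible M (K k)" and large: "large_along (4 * M) v (K k) (err k)" for k
    using f(1)[of k] by (auto simp: P_def K_def)
  have K_Suc: "K (Suc k) = adjoin (K k) (u (r k))" for k
    using f(2)[of k] by (simp add: Q_def K_def r_def)
  have r: "strict_mono r"
    unfolding strict_mono_Suc_iff r_def using f(2) by (simp add: Q_def)
  have K_mono: "K i \<subseteq> K j" if "i \<le> j" for i j
    by (rule lift_Suc_mono_le[OF _ that]) (simp add: K_Suc adjoin_superset[OF adm])
  \<comment> \<open>These are the combinations of total weight exactly 1. They form a convex set
    since the sets \<open>K k\<close> are convex and increasing.\<close>
  define C where "C = {z. \<exists>k. (z, 1) \<in> K k}"
  have "range (u \<circ> r) \<subseteq> C"
  proof clarify
    fix i
    have "(0 + 1 *\<^sub>R u (r i), 0 + 1) \<in> K (Suc i)"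
      unfolding K_Suc using adm[of i] by (intro adjoinI) (auto simp: admissible_def)
    then show "(u \<circ> r) i \<in> C" by (auto simp: C_def)
  qed
  moreover have "convex C"
  proof (rule convexI)
    fix z z' and a b :: real
    assume "z \<in> C" "z' \<in> C" and ab: "0 \<le> a" "0 \<le> b" "a + b = 1"
    then obtain i j where "(z, 1) \<in> K i" "(z', 1) \<in> K j" by (auto simp: C_def)
    then have "(z, 1) \<in> K (max i j)" "(z', 1) \<in> K (max i j)"
      using K_mono[of i "max i j"] K_mono[of j "max i j"] by auto
    then have "a *\<^sub>R (z, 1) + b *\<^sub>R (z', 1) \<in> K (max i j)"
      using adm ab by (intro convexD) (auto simp: admissible_def)
    then show "a *\<^sub>R z + b *\<^sub>R z' \<in> C" using ab by (auto simp: C_def)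
  qed
  ultimately have hull: "convex hull (range (u \<circ> r)) \<subseteq> C" by (rule hull_minimal)
  have "1 / 4 \<le> norm z" if z: "z \<in> C" for z
  proof -
    obtain k where k: "(z, 1) \<in> K k" using z by (auto simp: C_def)
    have "err k \<le> 1 / 4" by (simp add: err_def)
    \<comment> \<open>For \<open>s = 1\<close> the only permitted value is
      \<open>\<beta> = 4 * M\<close>. Cancelling \<open>4 * M * norm (v n)\<close> leaves
      \<open>norm (v n) - 1/2 - 1/4\<close>, whose limit is 1/4.\<close>
    have "\<forall>\<^sub>F n in sequentially. norm ((1 + 4 * M) *\<^sub>R v n) - 1 / 2 - err k \<le> norm (z + (4 * M) *\<^sub>R v n)"
      using large[of k] k unfolding large_along_def by fastforce
    then have "\<forall>\<^sub>F n in sequentially. norm (v n) - 3 / 4 \<le> norm z"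
    proof eventually_elim
      case (elim n)
      have "norm ((1 + 4 * M) *\<^sub>R v n) = norm (v n) + 4 * M * norm (v n)"
        using M(1) by (simp add: distrib_right)
      moreover have "norm (z + (4 * M) *\<^sub>R v n) \<le> norm z + 4 * M * norm (v n)"
        using norm_triangle_ineq[of z "(4 * M) *\<^sub>R v n"] M(1) by simp
      ultimately show ?case using elim \<open>err k \<le> 1 / 4\<close> by linarith
    qed
    moreover have "(\<lambda>n. norm (v n) - 3 / 4) \<longlonglongrightarrow> 1 - 3 / 4" by (intro tendsto_intros nv)
    ultimately have "1 - 3 / 4 \<le> norm z" by (intro tendsto_upperbound) auto
    then show ?thesis by simp
  qed
  with hull show thesis by (intro that[OF r]) auto
qed

section \<open>Contradiction with reflexivity, and the theorem\<close>

lemma bounded_sequence_convergent_subsequence: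
  fixes f :: "nat \<Rightarrow> real"
  assumes "\<And>n. a \<le> f n" "\<And>n. f n \<le> b"
  obtains l r where "a \<le> l" "strict_mono r" "(f \<circ> r) \<longlonglongrightarrow> l"
proof -
  have "seq_compact {a..b}" by (simp add: compact_imp_seq_compact)
  then obtain l r where "l \<in> {a..b}" "strict_mono r" "(f \<circ> r) \<longlonglongrightarrow> l"
    using assms unfolding seq_compact_def by (metis atLeastAtMost_iff)
  then show thesis using that by auto
qed

text \<open>The original norms need not converge, so subsequences are taken first; dividing by the
  limits \<open>a\<close> and \<open>b\<close> prepares the vectors for the selection. The common
  point \<open>z\<close> of the closed tail hulls has norm at least 1/4, yet lies in the closed span
  of every tail of \<open>x\<close>.\<close>

lemma renorm_two_not_reflexive:
  fixes c :: "nat \<Rightarrow> 'a::real_normed_vector"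
  assumes dense: "closure (range c) = UNIV"
    and x: "basic_sequence x" "\<And>m. renorm c (x m) = 1" and y: "\<And>n. renorm c (y n) = 1"
    and lim: "((\<lambda>p. renorm c (x (fst p) + y (snd p))) \<longlongrightarrow> 2) iterated_sequentially"
  shows "\<not> reflexive_space TYPE('a)"
proof
  assume refl: "reflexive_space TYPE('a)"
  define w where "w = 2 * renorm_weight c 0"
  have w: "w > 0" using renorm_weight_pos[of c 0] by (simp add: w_def)
  \<comment> \<open>The lower bound 1 keeps the limits \<open>a\<close> and \<open>b\<close> away
    from 0.\<close>
  have bounds: "1 \<le> norm z" "norm z \<le> 1 / w" if "renorm c z = 1" for z
    using renorm_le[of c z] renorm_ge[of c z] that w by (simp_all add: w_def field_simps)
  obtain a r where a: "1 \<le> a" "strict_mono r" "((\<lambda>m. norm (x m)) \<circ> r) \<longlonglongrightarrow> a"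
    using bounded_sequence_convergent_subsequence[of 1 "\<lambda>m. norm (x m)" "1 / w"] bounds x(2) by blast
  obtain b s where b: "1 \<le> b" "strict_mono s" "((\<lambda>n. norm (y n)) \<circ> s) \<longlonglongrightarrow> b"
    using bounded_sequence_convergent_subsequence[of 1 "\<lambda>n. norm (y n)" "1 / w"] bounds y by blast
  let ?F = iterated_sequentially
  let ?x = "\<lambda>p. x (r (fst p))" and ?y = "\<lambda>p. y (s (snd p))"
  have nx: "((\<lambda>p. norm (?x p)) \<longlongrightarrow> a) ?F"
    using filterlim_compose[OF a(3) filterlim_fst_iterated_sequentially] by (simp add: o_def)
  have ny: "((\<lambda>p. norm (?y p)) \<longlongrightarrow> b) ?F"
    using filterlim_compose[OF b(3) filterlim_snd_iterated_sequentially] by (simp add: o_def)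
  have "((\<lambda>p. renorm c (?x p + ?y p)) \<longlongrightarrow> 2) ?F"
    using filterlim_compose[OF lim filterlim_map_prod_iterated_sequentially[OF a(2) b(2)]] by simp
  then have "((\<lambda>p. renorm c (?x p) + renorm c (?y p) - renorm c (?x p + ?y p)) \<longlongrightarrow> 2 - 2) ?F"
    unfolding x y by (intro tendsto_intros) simp_all
  then have "((\<lambda>p. symm_norm z (?x p) + symm_norm z (?y p) - symm_norm z (?x p + ?y p)) \<longlongrightarrow> 0) ?F" for z
    using bounds x(2) y by (intro symm_norm_deficit_tendsto[OF dense, where M = "1 / w"]) auto
  note D = norm_combination_tendsto[OF this nx ny]
  define u where "u m = (1 / a) *\<^sub>R x (r m)" for m
  define v where "v n = (1 / b) *\<^sub>R y (s n)" for n
  have u: "a *\<^sub>R u m = x (r m)" for m using a by (simp add: u_def)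
  have v: "b *\<^sub>R v n = y (s n)" for n using b by (simp add: v_def)
  have nu: "(\<lambda>m. norm (u m)) \<longlonglongrightarrow> 1"
    using tendsto_divide[OF a(3) tendsto_const, of a] a(1) by (simp add: u_def o_def)
  have nv: "(\<lambda>n. norm (v n)) \<longlonglongrightarrow> 1"
    using tendsto_divide[OF b(3) tendsto_const, of b] b(1) by (simp add: v_def o_def)
  have "((\<lambda>p. \<alpha> * norm (z + u (fst p)) + \<beta> * norm (z + v (snd p))
      - norm (\<alpha> *\<^sub>R (z + u (fst p)) + \<beta> *\<^sub>R (z + v (snd p)))) \<longlongrightarrow> 0) ?F"
    if "\<alpha> \<ge> 0" "\<beta> \<ge> 0" for z \<alpha> \<beta>
  proof (rule weighted_norm_deficit_tendsto[of a _ b])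
    have 1: "a *\<^sub>R z + x (r m) = a *\<^sub>R (z + u m)" "b *\<^sub>R z + y (s n) = b *\<^sub>R (z + v n)"
      "(a + b) *\<^sub>R z + (x (r m) + y (s n)) = a *\<^sub>R (z + u m) + b *\<^sub>R (z + v n)" for m n
      by (simp_all add: scaleR_add_right scaleR_add_left u v)
    show "((\<lambda>p. a * norm (z + u (fst p)) + b * norm (z + v (snd p))
      - norm (a *\<^sub>R (z + u (fst p)) + b *\<^sub>R (z + v (snd p)))) \<longlongrightarrow> 0) ?F"
      using D[of z] a b unfolding 1 by simp
  qed (use a b that in auto)
  note merge = merge_lower_bound[OF this
      filterlim_compose[OF nu filterlim_fst_iterated_sequentially]
      filterlim_compose[OF nv filterlim_snd_iterated_sequentially]]
  have bound: "norm (u m) \<le> 1 / w" "norm (v n) \<le> 1 / w" for m n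
  proof -
    have "norm (u m) \<le> norm (x (r m))" "norm (v n) \<le> norm (y (s n))"
      unfolding u_def v_def using a b by (simp_all add: divide_le_eq mult_le_cancel_left1)
    then show "norm (u m) \<le> 1 / w" "norm (v n) \<le> 1 / w"
      using bounds(2)[OF x(2)[of "r m"]] bounds(2)[OF y[of "s n"]] by linarith+
  qed
  have iw: "1 / w > 0" using w by simp
  have "\<exists>t :: nat \<Rightarrow> nat. strict_mono t \<and> (\<forall>z\<in>convex hull (range (u \<circ> t)). 1 / 4 \<le> norm z)"
    by (rule subsequence_convex_hull_bounded_away[OF merge iw bound nv]) blast+
  then obtain t :: "nat \<Rightarrow> nat"
    where t: "strict_mono t" "\<And>z. z \<in> convex hull (range (u \<circ> t)) \<Longrightarrow> 1 / 4 \<le> norm z"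
    by blast
  obtain z where z: "\<And>j. z \<in> closure (convex hull ((u \<circ> t) ` {j..}))"
    by (rule reflexive_closed_convex_tails[OF refl, of "u \<circ> t" "1 / w"]) (use bound(1) in auto)
  have "convex hull ((u \<circ> t) ` {0..}) \<subseteq> {z. 1 / 4 \<le> norm z}" using t(2) by auto
  then have "closure (convex hull ((u \<circ> t) ` {0..})) \<subseteq> {z. 1 / 4 \<le> norm z}"
    by (rule closure_minimal) (intro closed_Collect_le continuous_intros)
  with z[of 0] have "1 / 4 \<le> norm z" by blast
  moreover have "z = 0"
  proof (rule basic_sequence_span_tails[OF x(1)])
    fix j
    have "(u \<circ> t) i \<in> span (x ` {j..})" if "i \<ge> j" for i
    proof -
      \<comment> \<open>Strictly increasing index maps satisfy \<open>i \<le> t i\<close> and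
        \<open>t i \<le> r (t i)\<close>, so tails of the subsequence stay in tails of
        \<open>x\<close>.\<close>
      have "j \<le> r (t i)"
        using that seq_suble[OF a(2), of "t i"] seq_suble[OF t(1), of i] by linarith
      then have "(1 / a) *\<^sub>R x (r (t i)) \<in> span (x ` {j..})"
        by (intro span_scale span_base) simp
      then show ?thesis by (simp add: u_def)
    qed
    then have "convex hull ((u \<circ> t) ` {j..}) \<subseteq> span (x ` {j..})"
      by (intro hull_minimal subspace_imp_convex subspace_span) auto
    then show "z \<in> closure (span (x ` {j..}))" using z[of j] closure_mono by blast
  qed
  ultimately show False by simp
qed

theorem theorem4p5:
  assumes "separable_space (euclidean :: 'a::banach topology)"
    and "infinite_dimensional TYPE('a)"
  shows "\<exists>N :: 'a \<Rightarrow> real. equivalent_norm N \<and>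
    ((\<exists>x y. basic_sequence x \<and> normalized_wrt N x \<and>
            basic_sequence y \<and> normalized_wrt N y \<and>
            (\<exists>L. (\<forall>m. (\<lambda>n. N (x m + y n)) \<longlonglongrightarrow> L m) \<and> L \<longlonglongrightarrow> 2))
      \<longrightarrow> \<not> reflexive_space TYPE('a))"
proof -
  obtain D :: "'a set" where D: "countable D" "closure D = UNIV"
    using assms(1) unfolding separable_space_def by auto
  \<comment> \<open>Only for nonempty \<open>D\<close> does \<open>from_nat_into D\<close> enumerate
    exactly \<open>D\<close>.\<close>
  then have "D \<noteq> {}" by auto
  with D have c: "closure (range (from_nat_into D)) = UNIV" by (simp add: range_from_nat_into)
  show ?thesis
  proof (intro exI[of _ "renorm (from_nat_into D)"] conjI impI equivalent_norm_renorm)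
    assume "\<exists>x y. basic_sequence x \<and> normalized_wrt (renorm (from_nat_into D)) x \<and>
            basic_sequence y \<and> normalized_wrt (renorm (from_nat_into D)) y \<and>
            (\<exists>L. (\<forall>m. (\<lambda>n. renorm (from_nat_into D) (x m + y n)) \<longlonglongrightarrow> L m) \<and> L \<longlonglongrightarrow> 2)"
    then obtain x y L where xy: "basic_sequence x" "normalized_wrt (renorm (from_nat_into D)) x"
      "normalized_wrt (renorm (from_nat_into D)) y"
      and L: "\<And>m. (\<lambda>n. renorm (from_nat_into D) (x m + y n)) \<longlonglongrightarrow> L m" "L \<longlonglongrightarrow> 2"
      by blast
    have "((\<lambda>p. renorm (from_nat_into D) (x (fst p) + y (snd p))) \<longlongrightarrow> 2) iterated_sequentially"
      by (rule tendsto_iterated_sequentially[OF _ L(2)]) (use L(1) in simp)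
    then show "\<not> reflexive_space TYPE('a)"
      using xy by (intro renorm_two_not_reflexive[OF c]) (auto simp: normalized_wrt_def)
  qed
qed

end
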